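(* If $S=S(\lambda_1,\ldots,\lambda_d)$ is a spider with $d\ge 6$ legs, then there is an integer partition $\mu$ of the number of vertices of $S$ such that $S$ has no connected partition of type $\mu$; in particular, $S$ is not $e$-positive.
   Context: A spider $S(\lambda_1,\ldots,\lambda_d)$, for positive integers $\lambda_1\ge\cdots\ge\lambda_d$, is the tree consisting of a vertex $v$ (the center) together with $d$ vertex-disjoint paths (legs) having $\lambda_1,\ldots,\lambda_d$ vertices respectively, where $v$ is joined by an edge to one endpoint of each leg. A connected partition of a graph $G=(V,E)$ is a partition of $V$ into blocks each inducing a connected subgraph; its type is the integer partition of $|V|$ formed by the block sizes. The chromatic symmetric function of $G$ is $X_G=\sum_\kappa \prod_{v} x_{\kappa(v)}$ over proper colorings $\kappa$; $G$ is $e$-positive if $X_G$ is a nonnegative linear combination of elementary symmetric functions $e_\lambda$. *)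

theory Defs
  imports Complex_Main "HOL-Library.Multiset" "HOL-Library.FuncSet"
begin

(* Simple graphs: finite vertex set V, symmetric irreflexive edge relation E. *)

definition connected_set :: "('a \<Rightarrow> 'a \<Rightarrow> bool) \<Rightarrow> 'a set \<Rightarrow> bool" where
  "connected_set E B \<longleftrightarrow> B \<noteq> {} \<and>
     (\<forall>x\<in>B. \<forall>y\<in>B. (\<lambda>u v. u \<in> B \<and> v \<in> B \<and> E u v)\<^sup>*\<^sup>* x y)"

definition connected_partition :: "'a set \<Rightarrow> ('a \<Rightarrow> 'a \<Rightarrow> bool) \<Rightarrow> 'a set set \<Rightarrow> bool" where
  "connected_partition V E P \<longleftrightarrow>
     \<Union>P = V \<and> (\<forall>B\<in>P. \<forall>C\<in>P. B \<noteq> C \<longrightarrow> B \<inter> C = {}) \<and> (\<forall>B\<in>P. connected_set E B)"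

definition partition_type :: "'a set set \<Rightarrow> nat multiset" where
  "partition_type P = image_mset card (mset_set P)"

definition int_partition :: "nat \<Rightarrow> nat multiset \<Rightarrow> bool" where
  "int_partition n \<mu> \<longleftrightarrow> (\<forall>k\<in>#\<mu>. 0 < k) \<and> sum_mset \<mu> = n"

(* Chromatic symmetric function, in N variables x_0..x_{N-1}:
   coefficient of the monomial prod_i x_i^(alpha i) *)
definition chrom_coeff :: "'a set \<Rightarrow> ('a \<Rightarrow> 'a \<Rightarrow> bool) \<Rightarrow> nat \<Rightarrow> (nat \<Rightarrow> nat) \<Rightarrow> nat" where
  "chrom_coeff V E N \<alpha> = card {\<kappa> \<in> V \<rightarrow>\<^sub>E {..<N}.
      (\<forall>u\<in>V. \<forall>v\<in>V. E u v \<longrightarrow> \<kappa> u \<noteq> \<kappa> v) \<and>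
      (\<forall>i<N. card {v\<in>V. \<kappa> v = i} = \<alpha> i)}"

(* coefficient of prod_i x_i^(alpha i) in e_mu = prod_j e_{mu_j}, in N variables *)
definition e_coeff :: "nat \<Rightarrow> nat multiset \<Rightarrow> (nat \<Rightarrow> nat) \<Rightarrow> nat" where
  "e_coeff N \<mu> \<alpha> = (let ls = sorted_list_of_multiset \<mu> in
     card {Ss :: nat set list. length Ss = length ls \<and>
        (\<forall>j<length ls. Ss ! j \<subseteq> {..<N} \<and> card (Ss ! j) = ls ! j) \<and>
        (\<forall>i<N. card {j. j < length ls \<and> i \<in> Ss ! j} = \<alpha> i)})"

(* e-positivity of X_G, tested in N = |V| variables (where the e_mu, mu |- |V|,
   form a basis of the homogeneous symmetric polynomials of degree |V|) *)
definition e_positive :: "'a set \<Rightarrow> ('a \<Rightarrow> 'a \<Rightarrow> bool) \<Rightarrow> bool" where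
  "e_positive V E \<longleftrightarrow> (let n = card V in
     \<exists>c :: nat multiset \<Rightarrow> real. (\<forall>\<mu>. 0 \<le> c \<mu>) \<and>
       (\<forall>\<alpha>. real (chrom_coeff V E n \<alpha>) =
              (\<Sum>\<mu>\<in>{\<mu>. int_partition n \<mu>}. c \<mu> * real (e_coeff n \<mu> \<alpha>))))"

(* Spider S(lam_1,...,lam_d): center (0,0); leg i (1 <= i <= d) has vertices
   (i,1),...,(i,lam_i); edges (0,0)-(i,1) and (i,j)-(i,j+1). *)
definition spider_V :: "nat list \<Rightarrow> (nat \<times> nat) set" where
  "spider_V lam = insert (0,0) {(i,j). 1 \<le> i \<and> i \<le> length lam \<and> 1 \<le> j \<and> j \<le> lam ! (i - 1)}"

definition spider_E :: "nat list \<Rightarrow> nat \<times> nat \<Rightarrow> nat \<times> nat \<Rightarrow> bool" where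
  "spider_E lam u v \<longleftrightarrow> u \<in> spider_V lam \<and> v \<in> spider_V lam \<and>
     (let adj = (\<lambda>(a,b) (c,e). (a = 0 \<and> b = 0 \<and> c \<ge> 1 \<and> e = 1) \<or>
                               (a \<ge> 1 \<and> c = a \<and> e = b + 1))
      in adj u v \<or> adj v u)"

end

theory Submission
  imports Defs
begin

text \<open>A missing type consists of parts lying in one interval \<open>[x, y]\<close>, chosen so that every short leg
  is smaller than \<open>x\<close> and must be contained in the block of the centre, and a longer leg cannot absorb
  enough blocks to keep that central block below \<open>y\<close>. Let \<open>a \<le> b \<le> c \<le> d \<le> e \<le> f\<close> be the six longest
  legs, \<open>T = a + b + c\<close>, and \<open>n\<close> the number of vertices. The interval \<open>[f + 1, n - 1]\<close> forces
  \<open>n \<ge> 4 d + 2 T + 1\<close>. If \<open>d\<close> is small compared to \<open>T\<^sup>2\<close>, then some interval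
  \<open>[d div j + 1, (d + T) div j]\<close> has a multiple reaching \<open>n\<close>; otherwise \<open>n > T\<^sup>2\<close> and \<open>[c + 1, T]\<close> does.

  For \<open>e\<close>-positivity, extract the coefficient of a power sum product \<open>p\<^sub>\<lambda>\<close> by substituting roots of unity.
  Up to a common nonzero factor, \<open>e\<^sub>\<mu>\<close> yields a nonnegative number, positive for \<open>e\<^sub>n\<close>, whereas the chromatic
  symmetric function yields 0 if there is no connected partition of type \<open>\<lambda>\<close>. Hence the coefficient of
  \<open>e\<^sub>n\<close> would vanish, contradicting that for a tree the coefficient of \<open>p\<^sub>n\<close> does not.\<close>

section \<open>Connected partitions of spiders\<close>

lemma spider_step:
  assumes "spider_E lam u v" "u \<noteq> (0,0)" "v \<noteq> (0,0)"
  shows "fst u = fst v"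
  using assms by (auto simp: spider_E_def Let_def split: prod.splits)

definition leg :: "nat list \<Rightarrow> nat \<Rightarrow> (nat \<times> nat) set" where
  "leg lam i = {i} \<times> {1..lam ! (i - 1)}"

lemma card_leg [simp]: "card (leg lam i) = lam ! (i - 1)"
  by (simp add: leg_def)

lemma finite_leg [simp]: "finite (leg lam i)"
  by (simp add: leg_def)

lemma spider_V_legs: "spider_V lam = insert (0,0) (\<Union>i\<in>{1..length lam}. leg lam i)"
  by (auto simp: spider_V_def leg_def)

lemma finite_spider_V [simp]: "finite (spider_V lam)"
  by (simp add: spider_V_legs)

lemma card_centre_legs:
  assumes "finite I" "0 \<notin> I"
  shows "card (insert (0,0) (\<Union>i\<in>I. leg lam i)) = Suc (\<Sum>i\<in>I. lam ! (i - 1))"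
proof -
  have "card (\<Union>i\<in>I. leg lam i) = (\<Sum>i\<in>I. card (leg lam i))"
    using assms by (intro card_UN_disjoint) (auto simp: leg_def)
  moreover have "(0,0) \<notin> (\<Union>i\<in>I. leg lam i)" using assms by (auto simp: leg_def)
  ultimately show ?thesis using assms by simp
qed

lemma card_spider_V: "card (spider_V lam) = Suc (\<Sum>i\<in>{1..length lam}. lam ! (i - 1))"
  unfolding spider_V_legs by (rule card_centre_legs) auto

text \<open>Distinct legs are joined only through the centre, so a path inside \<open>B\<close>
  never changes its first coordinate.\<close>

lemma connected_avoiding_centre:
  assumes "connected_set (spider_E lam) B" "B \<subseteq> spider_V lam" "(0,0) \<notin> B" "v \<in> B"
  shows "B \<subseteq> leg lam (fst v)"
proof
  fix w assume "w \<in> B"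
  then have "(\<lambda>u v. u \<in> B \<and> v \<in> B \<and> spider_E lam u v)\<^sup>*\<^sup>* v w"
    using assms unfolding connected_set_def by blast
  then have "fst w = fst v"
  proof (induction rule: rtranclp_induct)
    case (step y z)
    then show ?case using spider_step assms(3) by metis
  qed simp
  then show "w \<in> leg lam (fst v)"
    using \<open>w \<in> B\<close> assms(2,3) by (auto simp: spider_V_def leg_def)
qed

text \<open>The block of the centre swallows the legs in \<open>I\<close> entirely, and at most \<open>j - 1\<close> blocks fit
  into leg \<open>d\<close>, so what is left of that leg makes the central block larger than \<open>y\<close>.\<close>
lemma no_partition_with_blocks_in_interval:
  assumes P: "connected_partition (spider_V lam) (spider_E lam) P"
    and bounds: "\<And>B. B \<in> P \<Longrightarrow> x \<le> card B \<and> card B \<le> y"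
    and I: "I \<subseteq> {1..length lam}" "d \<in> {1..length lam}" "d \<notin> I"
    and small: "\<And>i. i \<in> I \<Longrightarrow> lam ! (i - 1) < x"
    and d: "lam ! (d - 1) < j * x" "j * y \<le> lam ! (d - 1) + (\<Sum>i\<in>I. lam ! (i - 1))"
  shows False
proof -
  have cover: "\<Union>P = spider_V lam"
    and disj: "\<And>B C. B \<in> P \<Longrightarrow> C \<in> P \<Longrightarrow> B \<noteq> C \<Longrightarrow> B \<inter> C = {}"
    and conn: "\<And>B. B \<in> P \<Longrightarrow> connected_set (spider_E lam) B"
    using P unfolding connected_partition_def by auto
  have sub: "B \<subseteq> spider_V lam" if "B \<in> P" for B using cover that by auto
  have finP: "finite P" by (rule finite_subset[of _ "Pow (spider_V lam)"]) (use sub in auto)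
  have finB: "finite B" if "B \<in> P" for B using sub[OF that] by (rule finite_subset) simp
  obtain B0 where B0: "B0 \<in> P" "(0,0) \<in> B0" using cover by (auto simp: spider_V_def)
  have other: "B \<subseteq> leg lam (fst v)" if "B \<in> P" "B \<noteq> B0" "v \<in> B" for B v
    using connected_avoiding_centre[OF conn sub] disj[OF that(1) B0(1) that(2)] that B0(2) by blast
  have finI: "finite I" and I0: "0 \<notin> I" using I(1) finite_subset by auto
  have legI: "leg lam i \<subseteq> B0" if "i \<in> I" for i
  proof
    fix v assume v: "v \<in> leg lam i"
    then have "v \<in> spider_V lam" using I that by (auto simp: spider_V_legs)
    then obtain B where B: "B \<in> P" "v \<in> B" using cover by auto
    have "B = B0"
    proof (rule ccontr)
      assume "B \<noteq> B0"
      moreover have "fst v = i" using v by (auto simp: leg_def)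
      ultimately have "B \<subseteq> leg lam i" using other[OF B(1) _ B(2)] by simp
      then have "card B \<le> lam ! (i - 1)" using card_mono[OF finite_leg] by fastforce
      then show False using small[OF that] bounds[OF B(1)] by simp
    qed
    then show "v \<in> B0" using B by simp
  qed
  \<comment> \<open>A block meeting leg \<open>d\<close> is either the central one, contributing
    \<open>R\<close>, or lies inside the leg and belongs to \<open>Q\<close>.\<close>
  define Q where "Q = {B \<in> P. B \<subseteq> leg lam d}"
  define R where "R = B0 \<inter> leg lam d"
  have Q: "finite Q" "Q \<subseteq> P" using finP by (auto simp: Q_def)
  have cardQ: "card (\<Union>Q) = sum card Q"
  proof (rule card_Union_disjoint)
    show "pairwise disjnt Q"
      unfolding pairwise_def disjnt_def using Q(2) disj by (meson subsetD)
  qed (use Q finB in auto)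
  have "\<Union>Q \<subseteq> leg lam d" by (auto simp: Q_def)
  then have "card (\<Union>Q) \<le> lam ! (d - 1)" using card_mono[OF finite_leg] by fastforce
  moreover have "card Q * x \<le> sum card Q"
    using sum_bounded_below[of Q x card] Q bounds by auto
  ultimately have "card Q * x < j * x" using cardQ d(1) by linarith
  then have Qj: "card Q < j" by (simp only: mult_less_cancel2)
  have "sum card Q \<le> card Q * y"
    using sum_bounded_above[of Q card y] Q bounds by auto
  also have "\<dots> \<le> (j - 1) * y" using Qj by (intro mult_right_mono) auto
  finally have sumQ: "sum card Q \<le> (j - 1) * y" .
  have "leg lam d \<subseteq> R \<union> \<Union>Q"
  proof
    fix v assume v: "v \<in> leg lam d"
    then have "v \<in> spider_V lam" using I by (auto simp: spider_V_legs)
    then obtain B where B: "B \<in> P" "v \<in> B" using cover by auto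
    show "v \<in> R \<union> \<Union>Q"
    proof (cases "B = B0")
      case True then show ?thesis using B v by (simp add: R_def)
    next
      case False
      moreover have "fst v = d" using v by (auto simp: leg_def)
      ultimately have "B \<subseteq> leg lam d" using other[OF B(1) _ B(2)] by simp
      then show ?thesis using B by (auto simp: Q_def)
    qed
  qed
  then have "lam ! (d - 1) \<le> card (R \<union> \<Union>Q)"
    using card_mono[of "R \<union> \<Union>Q" "leg lam d"] Q finB by (auto simp: R_def)
  also have "\<dots> \<le> card R + card (\<Union>Q)" by (rule card_Un_le)
  finally have R: "lam ! (d - 1) \<le> card R + (j - 1) * y" using cardQ sumQ by simp
  \<comment> \<open>The centre, the swallowed legs and \<open>R\<close> are disjoint pieces of
    \<open>B0\<close>. The legs and \<open>R\<close> alone have at least \<open>y\<close> vertices,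
    so counting the centre gives the contradiction.\<close>
  let ?J = "insert (0,0) (\<Union>i\<in>I. leg lam i)"
  have "?J \<inter> R = {}" using I by (auto simp: R_def leg_def)
  then have "card (?J \<union> R) = Suc (\<Sum>i\<in>I. lam ! (i - 1)) + card R"
    using card_Un_disjoint[of ?J R] card_centre_legs[OF finI I0, of lam] finI by (auto simp: R_def)
  moreover have "card (?J \<union> R) \<le> card B0"
    using legI B0 finB by (intro card_mono) (auto simp: R_def)
  ultimately have "Suc (\<Sum>i\<in>I. lam ! (i - 1)) + card R \<le> y" using bounds[OF B0(1)] by simp
  moreover have "j * y = (j - 1) * y + y" using Qj by (cases j) auto
  ultimately show False using R d(2) by linarith
qed

section \<open>Integer partitions with parts in an interval\<close>

text \<open>Divide \<open>n\<close> into \<open>p\<close> parts as evenly as possible: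
  \<open>n mod p\<close> parts are \<open>n div p + 1\<close>, the others
  \<open>n div p\<close>.\<close>

lemma ex_int_partition_in_interval:
  fixes n p x y :: nat
  assumes "0 < x" "p * x \<le> n" "n \<le> p * y"
  shows "\<exists>\<mu>. int_partition n \<mu> \<and> (\<forall>k\<in>#\<mu>. x \<le> k \<and> k \<le> y)"
proof (cases "p = 0")
  case True
  then show ?thesis using assms by (intro exI[of _ "{#}"]) (auto simp: int_partition_def)
next
  case False
  define q where "q = n div p"
  define s where "s = n mod p"
  have n: "n = p * q + s" by (simp add: q_def s_def)
  have s: "s < p" using False by (simp add: s_def)
  have xq: "x \<le> q" using assms(2) False by (simp add: q_def less_eq_div_iff_mult_less_eq mult.commute)
  have "q \<le> y" using assms(3) n False by (metis add_leD1 mult_le_cancel1 neq0_conv)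
  \<comment> \<open>The larger part occurs only if \<open>p\<close> does not divide
    \<open>n\<close>, and then \<open>p * q < n \<le> p * y\<close> leaves room for it.\<close>
  have qy: "Suc q \<le> y" if "s > 0"
  proof -
    have "p * q < p * y" using that n assms(3) by linarith
    then show ?thesis by simp
  qed
  let ?\<mu> = "replicate_mset s (Suc q) + replicate_mset (p - s) q"
  have "s * Suc q + (p - s) * q = n"
    using s n by (simp add: diff_mult_distrib algebra_simps)
  then have "int_partition n ?\<mu>" using xq assms(1)
    by (auto simp: int_partition_def split: if_splits)
  moreover have "\<forall>k\<in>#?\<mu>. x \<le> k \<and> k \<le> y" using xq \<open>q \<le> y\<close> qy by (auto split: if_splits)
  ultimately show ?thesis by blast
qed

text \<open>The bounds in \<open>p\<close> supply a type with \<open>p\<close> parts, all in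
  \<open>[x, y]\<close>; the conditions on leg \<open>d\<close> and the swallowed legs
  \<open>I\<close> exclude it.\<close>

lemma spider_missing_type:
  assumes I: "I \<subseteq> {1..length lam}" "d \<in> {1..length lam}" "d \<notin> I"
    and small: "\<And>i. i \<in> I \<Longrightarrow> lam ! (i - 1) < x"
    and d: "lam ! (d - 1) < j * x" "j * y \<le> lam ! (d - 1) + (\<Sum>i\<in>I. lam ! (i - 1))"
    and p: "p * x \<le> card (spider_V lam)" "card (spider_V lam) \<le> p * y"
  shows "\<exists>\<mu>. int_partition (card (spider_V lam)) \<mu> \<and>
            \<not> (\<exists>P. connected_partition (spider_V lam) (spider_E lam) P \<and> partition_type P = \<mu>)"
proof -
  have "0 < x" using d(1) by (cases x) auto
  then obtain \<mu> where \<mu>: "int_partition (card (spider_V lam)) \<mu>" "\<forall>k\<in>#\<mu>. x \<le> k \<and> k \<le> y"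
    using ex_int_partition_in_interval p by blast
  have False if P: "connected_partition (spider_V lam) (spider_E lam) P" "partition_type P = \<mu>" for P
  proof (rule no_partition_with_blocks_in_interval[OF P(1) _ I small d])
    fix B assume "B \<in> P"
    moreover have "finite P"
      by (rule finite_subset[of _ "Pow (spider_V lam)"]) (use P(1) in \<open>auto simp: connected_partition_def\<close>)
    ultimately have "card B \<in># \<mu>" using P(2) by (auto simp: partition_type_def)
    then show "x \<le> card B \<and> card B \<le> y" using \<mu> by blast
  qed
  then show ?thesis using \<mu> by blast
qed

text \<open>The witness is \<open>n div x\<close>: the remainder, at most \<open>x - 1\<close>, is
  spread over at least \<open>q\<close> parts, each with slack \<open>y - x\<close>.\<close>

lemma interval_multiple:
  fixes n x y :: nat
  assumes "0 < x" "x \<le> y" "q * x \<le> n" "x - 1 \<le> q * (y - x)"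
  shows "\<exists>p. p * x \<le> n \<and> n \<le> p * y"
proof (intro exI conjI)
  show "n div x * x \<le> n" by simp
  have "q \<le> n div x" using assms by (simp add: less_eq_div_iff_mult_less_eq)
  then have "x - 1 \<le> n div x * (y - x)"
    using assms(4) by (meson le_trans mult_le_mono1)
  moreover have "n \<le> n div x * x + (x - 1)"
    using assms(1) by (metis add_left_mono div_mult_mod_eq less_Suc_eq_le Suc_pred' mod_less_divisor)
  moreover have "n div x * y = n div x * x + n div x * (y - x)"
    using assms(2) by (metis add_mult_distrib2 le_add_diff_inverse)
  ultimately show "n \<le> n div x * y" by linarith
qed

text \<open>The alternatives serve two obstructions: dividing leg \<open>d\<close> while
  \<open>a\<close>, \<open>b\<close>, \<open>c\<close> are swallowed, or dividing leg
  \<open>c\<close> with \<open>j = 1\<close> while \<open>a\<close> and \<open>b\<close> are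
  swallowed.\<close>

lemma interval_choice:
  fixes a b c d n :: nat
  defines "T \<equiv> a + b + c"
  assumes "0 < a" "a \<le> b" "b \<le> c" "c \<le> d" and n: "4 * d + 2 * T + 1 \<le> n"
  shows "(\<exists>j x y p. c < x \<and> d < j * x \<and> j * y \<le> d + T \<and> p * x \<le> n \<and> n \<le> p * y) \<or>
         (\<exists>p. p * (c + 1) \<le> n \<and> n \<le> p * T)"
proof (cases "d < T")
  case True
  have "\<exists>p. p * (d + 1) \<le> n \<and> n \<le> p * (d + T)"
    by (rule interval_multiple[of _ _ 4]) (use assms True in auto)
  moreover have "c < d + 1" "d < 1 * (d + 1)" "1 * (d + T) \<le> d + T" using assms by auto
  ultimately show ?thesis by blast
next
  case False
  \<comment> \<open>This choice puts \<open>d div j\<close> between \<open>T\<close> and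
    \<open>2 * T\<close>: the lower bound gives \<open>c < x\<close>, the upper one keeps
    \<open>x - 1\<close> small.\<close>
  define j where "j = d div T"
  have T: "3 \<le> T" using assms by simp
  have j: "0 < j" "j * T \<le> d" "d < j * T + T"
    using False T dividend_less_div_times[of T d] by (auto simp: j_def div_greater_zero_iff)
  show ?thesis
  proof (cases "4 * j \<le> T + 2")
    case True
    define x where "x = d div j + 1"
    define y where "y = (d + T) div j"
    have jx: "d < j * x" "j * x \<le> d + j"
      using j(1) dividend_less_div_times[of j d] by (auto simp: x_def algebra_simps)
    have jy: "j * y \<le> d + T" "d + T < j * y + j"
      using j(1) dividend_less_div_times[of j "d + T"] by (auto simp: y_def algebra_simps)
    have "T \<le> d div j" using j by (simp add: less_eq_div_iff_mult_less_eq mult.commute)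
    then have x: "c < x" by (simp add: x_def T_def)
    have "j * x < j * (y + 1)" using jx jy True T by simp
    then have "x < y + 1" by (simp only: mult_less_cancel1)
    then have xy: "x \<le> y" by simp
    have "d < j * (2 * T)" using j T by (cases j) auto
    then have "d div j < 2 * T" using j(1) by (simp add: less_mult_imp_div_less mult.commute)
    then have x2: "x \<le> 2 * T" by (simp add: x_def)
    have "\<exists>p. p * x \<le> n \<and> n \<le> p * y"
    proof (rule interval_multiple[of _ _ "4 * j"])
      show "4 * j * x \<le> n" using jx n True by simp
      \<comment> \<open>Rounding leaves \<open>j * (y - x)\<close> at least
        \<open>T - 2 * j + 1\<close>. The threshold \<open>4 * j \<le> T + 2\<close> turns this into
        \<open>4 * j * (y - x) \<ge> 2 * T\<close>, and \<open>x\<close> is at most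
        \<open>2 * T\<close>.\<close>
      have "j * (y - x) = j * y - j * x" by (simp add: diff_mult_distrib2)
      then show "x - 1 \<le> 4 * j * (y - x)" using jx jy x2 True by simp
    qed (use xy x in auto)
    then show ?thesis using x jx jy by blast
  next
    case False
    \<comment> \<open>Now \<open>n \<ge> T * (T + 3)\<close>, so at least \<open>c + 1\<close> parts
      of size \<open>c + 1\<close> fit, and since \<open>a + b \<ge> 2\<close> a slack of 1 per part
      absorbs the remainder.\<close>
    have "T * (T + 3) \<le> T * (4 * j)" using False by (intro mult_left_mono) auto
    then have "T * (T + 3) \<le> n" using j(2) n by (simp add: algebra_simps)
    moreover have "(c + 1) * (c + 1) \<le> T * (T + 3)" using assms by (intro mult_mono) auto
    ultimately have "\<exists>p. p * (c + 1) \<le> n \<and> n \<le> p * T"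
    proof (intro interval_multiple[of _ _ "c + 1"])
      have "(c + 1) * 1 \<le> (c + 1) * (T - (c + 1))" using assms by (intro mult_left_mono) auto
      then show "c + 1 - 1 \<le> (c + 1) * (T - (c + 1))" by simp
    qed (use assms in auto)
    then show ?thesis by blast
  qed
qed

section \<open>Spiders with at least six legs\<close>

lemma six_legs_missing_type:
  fixes lam :: "nat list"
  assumes len: "length lam \<ge> 6" and pos: "\<forall>k\<in>set lam. 0 < k" and sorted: "sorted (rev lam)"
  shows "\<exists>\<mu>. int_partition (card (spider_V lam)) \<mu> \<and>
            \<not> (\<exists>P. connected_partition (spider_V lam) (spider_E lam) P \<and> partition_type P = \<mu>)"
proof -
  let ?l = "\<lambda>i. lam ! (i - 1)"
  let ?n = "card (spider_V lam)"
  have mono: "lam ! j \<le> lam ! i" if "i \<le> j" "j < length lam" for i j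
    using sorted_rev_nth_mono[OF sorted that] .
  have chain: "0 < lam ! 5" "lam ! 5 \<le> lam ! 4" "lam ! 4 \<le> lam ! 3" "lam ! 3 \<le> lam ! 2"
    "lam ! 2 \<le> lam ! 1"
    using mono pos len by auto
  have split1: "(\<Sum>i\<in>{1..length lam}. ?l i) = lam ! 0 + (\<Sum>i\<in>{2..length lam}. ?l i)"
    using len by (subst sum.atLeast_Suc_atMost) (auto simp: numeral_2_eq_2)
  have five: "lam ! 1 + lam ! 2 + lam ! 3 + lam ! 4 + lam ! 5 \<le> (\<Sum>i\<in>{2..length lam}. ?l i)"
  proof -
    have "{2..6::nat} = {2,3,4,5,6}" by auto
    then have "(\<Sum>i\<in>{2..6}. ?l i) = lam ! 1 + lam ! 2 + lam ! 3 + lam ! 4 + lam ! 5" by simp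
    moreover have "(\<Sum>i\<in>{2..6}. ?l i) \<le> (\<Sum>i\<in>{2..length lam}. ?l i)"
      using len by (intro sum_mono2) auto
    ultimately show ?thesis by linarith
  qed
  show ?thesis
  proof (cases "2 * (lam ! 0 + 1) \<le> ?n")
    case True
    \<comment> \<open>No leg can hold a block here, so the whole spider is the only possible block,
      and the bound \<open>y\<close> excludes it. The case assumption lets two parts sum to
      \<open>?n\<close>.\<close>
    show ?thesis
    proof (rule spider_missing_type[where I = "{2..length lam}" and d = 1 and j = 1
            and x = "lam ! 0 + 1" and y = "?n - 1" and p = 2])
      fix i assume "i \<in> {2..length lam}"
      then have "i - 1 < length lam" by auto
      then show "lam ! (i - 1) < lam ! 0 + 1" using mono[of 0 "i - 1"] by simp
    qed (use True len split1 card_spider_V[of lam] in auto)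
  next
    case False
    define T where "T = lam ! 5 + lam ! 4 + lam ! 3"
    \<comment> \<open>The longest leg is at least as long as all the others together, so
      \<open>?n\<close> exceeds twice their total.\<close>
    have "4 * lam ! 2 + 2 * T + 1 \<le> ?n"
      using False split1 five card_spider_V[of lam] chain(5) by (simp add: T_def)
    then consider (four) j x y p where "lam ! 3 < x" "lam ! 2 < j * x" "j * y \<le> lam ! 2 + T"
        "p * x \<le> ?n" "?n \<le> p * y"
      | (three) p where "p * (lam ! 3 + 1) \<le> ?n" "?n \<le> p * T"
      using interval_choice[OF chain(1-4)] unfolding T_def by blast
    then show ?thesis
    proof cases
      case four
      \<comment> \<open>Legs are numbered from 1 and list entries from 0, so leg 3 has length
        \<open>lam ! 2\<close> and legs 4, 5, 6 make up \<open>T\<close>.\<close>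
      show ?thesis
      proof (rule spider_missing_type[where I = "{4,5,6}" and d = 3 and j = j and x = x and y = y and p = p])
        show "lam ! (i - 1) < x" if "i \<in> {4,5,6}" for i using that four chain by auto
      qed (use four len in \<open>auto simp: T_def\<close>)
    next
      case three
      show ?thesis
      proof (rule spider_missing_type[where I = "{5,6}" and d = 4 and j = 1 and x = "lam ! 3 + 1" and y = T and p = p])
        show "lam ! (i - 1) < lam ! 3 + 1" if "i \<in> {5,6}" for i using that chain by auto
      qed (use three len in \<open>auto simp: T_def\<close>)
    qed
  qed
qed

section \<open>Power sum coefficients via roots of unity\<close>

text \<open>With \<open>g = w / (1 - \<xi>)\<close>, each term is \<open>g x - g (\<rho> x)\<close>
  because \<open>\<xi>\<close> is constant along \<open>\<rho>\<close>; the differences cancel since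
  \<open>\<rho>\<close> permutes the finite set \<open>X\<close>.\<close>

lemma sum_eq_0_if_rotated:
  fixes w :: "'a \<Rightarrow> 'b::field"
  assumes "finite X" and into: "\<And>x. x \<in> X \<Longrightarrow> \<rho> x \<in> X" and inj: "inj_on \<rho> X"
    and w: "\<And>x. x \<in> X \<Longrightarrow> w (\<rho> x) = \<xi> x * w x"
    and \<xi>: "\<And>x. x \<in> X \<Longrightarrow> \<xi> (\<rho> x) = \<xi> x" "\<And>x. x \<in> X \<Longrightarrow> \<xi> x \<noteq> 1"
  shows "sum w X = 0"
proof -
  define g where "g x = w x / (1 - \<xi> x)" for x
  have "\<rho> ` X = X" using assms by (intro endo_inj_surj) auto
  then have "sum g X = sum (g \<circ> \<rho>) X" using sum.reindex[OF inj, of g] by simp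
  then have "0 = (\<Sum>x\<in>X. g x - g (\<rho> x))" by (simp add: sum_subtractf)
  also have "\<dots> = sum w X"
  proof (rule sum.cong[OF refl])
    fix x assume x: "x \<in> X"
    have "g x - g (\<rho> x) = (w x - \<xi> x * w x) / (1 - \<xi> x)"
      using w[OF x] \<xi>(1)[OF x] by (simp add: g_def diff_divide_distrib)
    also have "\<dots> = w x" using \<xi>(2)[OF x] by (simp add: divide_simps algebra_simps)
    finally show "g x - g (\<rho> x) = w x" .
  qed
  finally show ?thesis by simp
qed

lemma sum_split_rotated:
  fixes w :: "'a \<Rightarrow> 'b::field"
  assumes "finite X" and into: "\<And>x. x \<in> X \<Longrightarrow> \<not> G x \<Longrightarrow> \<rho> x \<in> X \<and> \<not> G (\<rho> x)"
    and "inj_on \<rho> {x \<in> X. \<not> G x}"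
    and "\<And>x. x \<in> X \<Longrightarrow> \<not> G x \<Longrightarrow> w (\<rho> x) = \<xi> x * w x"
    and "\<And>x. x \<in> X \<Longrightarrow> \<not> G x \<Longrightarrow> \<xi> (\<rho> x) = \<xi> x \<and> \<xi> x \<noteq> 1"
  shows "sum w X = sum w {x \<in> X. G x}"
proof -
  have "sum w {x \<in> X. \<not> G x} = 0"
    by (rule sum_eq_0_if_rotated[where \<rho> = \<rho> and \<xi> = \<xi>]) (use assms in auto)
  moreover have "sum w X = sum w {x \<in> X. G x} + sum w {x \<in> X. \<not> G x}"
    using sum.Int_Diff[OF \<open>finite X\<close>, of w "{x. G x}"] by (simp add: Int_def set_diff_eq)
  ultimately show ?thesis by simp
qed

text \<open>Evaluating a symmetric polynomial of degree \<open>N\<close> at \<open>t\<^sub>b \<zeta>\<close>, for \<open>b < k\<close> and \<open>\<zeta>\<close> running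
  through the \<open>L b\<close>-th roots of unity, and taking the coefficient of \<open>\<Prod> t\<^sub>b ^ L b\<close>, extracts its
  coefficient at the power sum product \<open>\<Prod> p\<^bsub>L b\<^esub>\<close> up to a nonzero factor. Variable \<open>i\<close> is sent to
  \<open>t\<^bsub>blk i\<^esub> * z i\<close>, and \<open>r\<close> rotates the roots of unity within each block.\<close>
locale root_blocks =
  fixes N k :: nat and L blk r :: "nat \<Rightarrow> nat" and z \<omega> :: "nat \<Rightarrow> complex"
  assumes blk_less: "i < N \<Longrightarrow> blk i < k"
    and r_less: "i < N \<Longrightarrow> r i < N"
    and inj_r: "inj_on r {..<N}"
    and blk_r: "i < N \<Longrightarrow> blk (r i) = blk i"
    and z_r: "i < N \<Longrightarrow> z (r i) = \<omega> (blk i) * z i"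
    and rot_pow: "b < k \<Longrightarrow> 0 < m \<Longrightarrow> m < L b \<Longrightarrow> \<omega> b ^ m \<noteq> 1"
    and z_pow: "i < N \<Longrightarrow> z i ^ L (blk i) = 1"
    and card_blk: "b < k \<Longrightarrow> card {i. i < N \<and> blk i = b} = L b"
    and L_pos: "b < k \<Longrightarrow> 0 < L b"
begin

definition block :: "nat \<Rightarrow> nat set" where
  "block b = {i. i < N \<and> blk i = b}"

text \<open>The coefficient of \<open>\<Prod> t_b ^ L b\<close> that the monomial with exponents
  \<open>\<alpha>\<close> acquires under the substitution.\<close>

definition weight :: "(nat \<Rightarrow> nat) \<Rightarrow> complex" where
  "weight \<alpha> = (if \<forall>b<k. (\<Sum>i\<in>block b. \<alpha> i) = L b then \<Prod>i<N. z i ^ \<alpha> i else 0)"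

text \<open>\<open>f\<close> lists the coefficients of a polynomial. Exponents up to
  \<open>N\<close> cover all monomials of degree \<open>N\<close>.\<close>

definition psum_coeff :: "((nat \<Rightarrow> nat) \<Rightarrow> nat) \<Rightarrow> complex" where
  "psum_coeff f = (\<Sum>\<alpha>\<in>{..<N} \<rightarrow>\<^sub>E {..N}. of_nat (f \<alpha>) * weight \<alpha>)"

definition root_prod :: complex where
  "root_prod = (\<Prod>i<N. z i)"

lemma z_nonzero: "i < N \<Longrightarrow> z i \<noteq> 0"
  using z_pow[of i] L_pos[OF blk_less[of i]] by (auto simp: power_0_left)

lemma root_prod_nonzero: "root_prod \<noteq> 0"
  by (simp add: root_prod_def z_nonzero)

lemma finite_block [simp]: "finite (block b)"
  by (simp add: block_def)

lemma card_block: "b < k \<Longrightarrow> card (block b) = L b"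
  by (simp add: block_def card_blk)

lemma blk_eq_0: "k = 1 \<Longrightarrow> i < N \<Longrightarrow> blk i = 0"
  using blk_less[of i] by simp

lemma single_block:
  assumes "k = 1"
  shows "L 0 = N"
proof -
  have "{i. i < N \<and> blk i = 0} = {..<N}" using blk_eq_0[OF assms] by auto
  then show ?thesis using card_blk[of 0] assms by simp
qed

lemma block_subset: "block b \<subseteq> {..<N}"
  by (auto simp: block_def)

lemma r_block: "r ` block b \<subseteq> block b"
  by (auto simp: block_def r_less blk_r)

lemma inj_on_r: "A \<subseteq> {..<N} \<Longrightarrow> inj_on r A"
  using inj_r inj_on_subset by blast

lemma weight_cong: "(\<And>i. i < N \<Longrightarrow> \<alpha> i = \<beta> i) \<Longrightarrow> weight \<alpha> = weight \<beta>"
proof -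
  assume eq: "\<And>i. i < N \<Longrightarrow> \<alpha> i = \<beta> i"
  have "(\<Sum>i\<in>block b. \<alpha> i) = (\<Sum>i\<in>block b. \<beta> i)" for b
    using eq by (intro sum.cong) (auto simp: block_def)
  moreover have "(\<Prod>i<N. z i ^ \<alpha> i) = (\<Prod>i<N. z i ^ \<beta> i)" using eq by simp
  ultimately show ?thesis unfolding weight_def by (simp only:)
qed

text \<open>For an \<open>f\<close> that counts objects by content, the extraction becomes a sum of
  weights over the objects themselves, on which rotations can act.\<close>

lemma psum_coeff_card:
  assumes "finite X" "\<And>x i. x \<in> X \<Longrightarrow> i < N \<Longrightarrow> cont x i \<le> N"
    and f: "\<And>\<alpha>. f \<alpha> = card {x \<in> X. \<forall>i<N. cont x i = \<alpha> i}"
  shows "psum_coeff f = (\<Sum>x\<in>X. weight (cont x))"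
proof -
  let ?A = "{..<N} \<rightarrow>\<^sub>E {..N}"
  let ?g = "\<lambda>x. restrict (cont x) {..<N}"
  have "psum_coeff f = (\<Sum>\<alpha>\<in>?A. \<Sum>x\<in>{x \<in> X. ?g x = \<alpha>}. weight (cont x))"
    unfolding psum_coeff_def
  proof (rule sum.cong[OF refl])
    fix \<alpha> assume \<alpha>: "\<alpha> \<in> ?A"
    have "(?g x = \<alpha>) = (\<forall>i<N. cont x i = \<alpha> i)" for x
      using \<alpha> by (auto simp: fun_eq_iff PiE_def extensional_def restrict_def)
    then have "f \<alpha> = card {x \<in> X. ?g x = \<alpha>}" by (simp add: f)
    moreover have "weight (cont x) = weight \<alpha>" if "x \<in> {x \<in> X. ?g x = \<alpha>}" for x
      using that by (intro weight_cong) auto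
    ultimately show "of_nat (f \<alpha>) * weight \<alpha> = (\<Sum>x\<in>{x \<in> X. ?g x = \<alpha>}. weight (cont x))"
      by simp
  qed
  also have "\<dots> = (\<Sum>x\<in>X. weight (cont x))"
  proof (rule sum.group)
    show "?g ` X \<subseteq> ?A" using assms(2) by (simp add: image_subset_iff restrict_PiE_iff)
  qed (use assms(1) in \<open>auto simp: finite_PiE\<close>)
  finally show ?thesis .
qed

section \<open>Elementary symmetric polynomials\<close>

text \<open>Each set picks a monomial from one factor of the product of the \<open>e_l\<close>;
  these lists are the objects counted by \<open>e_coeff\<close>.\<close>

definition e_choices :: "nat list \<Rightarrow> nat set list set" where
  "e_choices ls = {Ss. length Ss = length ls \<and> (\<forall>j<length ls. Ss ! j \<subseteq> {..<N} \<and> card (Ss ! j) = ls ! j)}"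

definition occurrences :: "nat set list \<Rightarrow> nat \<Rightarrow> nat" where
  "occurrences Ss i = card {j. j < length Ss \<and> i \<in> Ss ! j}"

lemma finite_e_choices: "finite (e_choices ls)"
proof (rule finite_subset)
  show "e_choices ls \<subseteq> {Ss. set Ss \<subseteq> Pow {..<N} \<and> length Ss = length ls}"
    unfolding e_choices_def by (auto simp: in_set_conv_nth) blast
  show "finite {Ss. set Ss \<subseteq> Pow {..<N} \<and> length Ss = length ls}"
    by (rule finite_lists_length_eq) simp
qed

lemma sum_occurrences: "(\<Sum>i\<in>block b. occurrences Ss i) = (\<Sum>j<length Ss. card (Ss ! j \<inter> block b))"
proof -
  have "occurrences Ss i = (\<Sum>j<length Ss. if i \<in> Ss ! j then 1 else 0)" for i
    by (simp add: occurrences_def sum.If_cases Int_def)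
  then have "(\<Sum>i\<in>block b. occurrences Ss i) = (\<Sum>j<length Ss. \<Sum>i\<in>block b. if i \<in> Ss ! j then 1 else 0)"
    by (simp add: sum.swap[of _ "block b"])
  then show ?thesis by (simp add: sum.If_cases Int_commute)
qed

lemma prod_occurrences:
  assumes "\<forall>j<length Ss. Ss ! j \<subseteq> {..<N}"
  shows "(\<Prod>i<N. z i ^ occurrences Ss i) = (\<Prod>j<length Ss. \<Prod>i\<in>Ss ! j. z i)"
proof -
  have "z i ^ occurrences Ss i = (\<Prod>j<length Ss. if i \<in> Ss ! j then z i else 1)" for i
    by (simp add: occurrences_def prod.If_cases Int_def)
  then have "(\<Prod>i<N. z i ^ occurrences Ss i) = (\<Prod>j<length Ss. \<Prod>i<N. if i \<in> Ss ! j then z i else 1)"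
    by (simp add: prod.swap[of _ "{..<N}"])
  also have "\<dots> = (\<Prod>j<length Ss. \<Prod>i\<in>Ss ! j. z i)"
  proof (rule prod.cong[OF refl])
    fix j assume "j \<in> {..<length Ss}"
    then have "{..<N} \<inter> {i. i \<in> Ss ! j} = Ss ! j" using assms by auto
    then show "(\<Prod>i<N. if i \<in> Ss ! j then z i else 1) = (\<Prod>i\<in>Ss ! j. z i)"
      by (simp add: prod.If_cases)
  qed
  finally show ?thesis .
qed

definition rotate_in :: "nat \<Rightarrow> nat \<Rightarrow> nat set list \<Rightarrow> nat set list" where
  "rotate_in j b Ss = Ss[j := (Ss ! j - block b) \<union> r ` (Ss ! j \<inter> block b)]"

lemma rotated_Int_block:
  assumes "S \<subseteq> {..<N}"
  shows "((S - block b) \<union> r ` (S \<inter> block b)) \<inter> block b = r ` (S \<inter> block b)"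
    and "((S - block b) \<union> r ` (S \<inter> block b)) - block b = S - block b"
    and "b' \<noteq> b \<Longrightarrow> ((S - block b) \<union> r ` (S \<inter> block b)) \<inter> block b' = S \<inter> block b'"
  using assms r_block[of b] by (auto simp: block_def)

lemma card_rotated_Int:
  assumes "S \<subseteq> {..<N}"
  shows "card (((S - block b) \<union> r ` (S \<inter> block b)) \<inter> block b') = card (S \<inter> block b')"
proof (cases "b' = b")
  case True
  then show ?thesis
    using rotated_Int_block(1)[OF assms] card_image[OF inj_on_r, of "S \<inter> block b"] assms by auto
qed (use rotated_Int_block(3)[OF assms] in simp)

lemma card_rotated:
  assumes "S \<subseteq> {..<N}"
  shows "card ((S - block b) \<union> r ` (S \<inter> block b)) = card S"
proof -
  have fin: "finite S" using assms finite_subset by blast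
  have "card ((S - block b) \<union> r ` (S \<inter> block b)) = card (S - block b) + card (S \<inter> block b)"
    using r_block[of b] fin card_image[OF inj_on_r, of "S \<inter> block b"] assms
    by (subst card_Un_disjoint) auto
  also have "\<dots> = card S" using card_Int_Diff[OF fin, of "block b"] by simp
  finally show ?thesis .
qed

lemma prod_rotated:
  assumes "S \<subseteq> {..<N}"
  shows "(\<Prod>i\<in>(S - block b) \<union> r ` (S \<inter> block b). z i) = \<omega> b ^ card (S \<inter> block b) * (\<Prod>i\<in>S. z i)"
proof -
  have fin: "finite S" using assms finite_subset by blast
  have "(\<Prod>i\<in>r ` (S \<inter> block b). z i) = (\<Prod>i\<in>S \<inter> block b. \<omega> b * z i)"
    using assms by (subst prod.reindex[OF inj_on_r]) (auto simp: z_r block_def intro!: prod.cong)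
  also have "\<dots> = \<omega> b ^ card (S \<inter> block b) * (\<Prod>i\<in>S \<inter> block b. z i)"
    by (simp add: prod.distrib)
  finally have "(\<Prod>i\<in>(S - block b) \<union> r ` (S \<inter> block b). z i) =
      (\<Prod>i\<in>S - block b. z i) * (\<omega> b ^ card (S \<inter> block b) * (\<Prod>i\<in>S \<inter> block b. z i))"
    using r_block[of b] fin by (subst prod.union_disjoint) auto
  also have "\<dots> = \<omega> b ^ card (S \<inter> block b) * ((\<Prod>i\<in>S \<inter> block b. z i) * (\<Prod>i\<in>S - block b. z i))"
    by simp
  also have "(\<Prod>i\<in>S \<inter> block b. z i) * (\<Prod>i\<in>S - block b. z i) = (\<Prod>i\<in>S. z i)"
    using prod.Int_Diff[OF fin, of z "block b"] by simp
  finally show ?thesis .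
qed

text \<open>As \<open>r\<close> keeps the block, the parts of \<open>S\<close> outside and inside it
  can be recovered separately from the image.\<close>

lemma rotated_inj:
  assumes "S \<subseteq> {..<N}" "S' \<subseteq> {..<N}"
    and eq: "(S - block b) \<union> r ` (S \<inter> block b) = (S' - block b) \<union> r ` (S' \<inter> block b)"
  shows "S = S'"
proof -
  have "S - block b = S' - block b"
    using rotated_Int_block(2)[OF assms(1)] rotated_Int_block(2)[OF assms(2)] eq by metis
  moreover have "r ` (S \<inter> block b) = r ` (S' \<inter> block b)"
    using rotated_Int_block(1)[OF assms(1)] rotated_Int_block(1)[OF assms(2)] eq by metis
  then have "S \<inter> block b = S' \<inter> block b"
    using inj_on_image_eq_iff[OF inj_r] assms by (metis block_subset le_infI2)
  ultimately show ?thesis by blast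
qed

text \<open>The choices that survive cancellation: every set is a union of blocks and each block
  lies in exactly one set. They count the ways to distribute the blocks so that set \<open>j\<close>
  gets total size \<open>ls ! j\<close>.\<close>

definition e_good :: "nat list \<Rightarrow> nat set list set" where
  "e_good ls = {Ss \<in> e_choices ls. (\<forall>b<k. (\<Sum>j<length ls. card (Ss ! j \<inter> block b)) = L b) \<and>
     (\<forall>j<length ls. \<forall>b<k. card (Ss ! j \<inter> block b) = 0 \<or> card (Ss ! j \<inter> block b) = L b)}"

text \<open>If a set meets block \<open>b\<close> in \<open>m\<close> elements with
  \<open>0 < m < L b\<close>, rotating that intersection multiplies the weight by
  \<open>\<omega> b ^ m \<noteq> 1\<close>, so such choices cancel. Each survivor uses every
  variable exactly once and has weight \<open>root_prod\<close>. The length bound keeps all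
  exponents at most \<open>N\<close>.\<close>

lemma psum_coeff_e:
  assumes len: "length (sorted_list_of_multiset \<mu>) \<le> N"
  shows "psum_coeff (e_coeff N \<mu>) = root_prod * of_nat (card (e_good (sorted_list_of_multiset \<mu>)))"
proof -
  define ls where "ls = sorted_list_of_multiset \<mu>"
  define sh where "sh Ss j b = card (Ss ! j \<inter> block b)" for Ss :: "nat set list" and j b
  define X where "X = {Ss \<in> e_choices ls. \<forall>b<k. (\<Sum>j<length ls. sh Ss j b) = L b}"
  define w where "w Ss = (\<Prod>j<length ls. \<Prod>i\<in>Ss ! j. z i)" for Ss :: "nat set list"
  define gd where "gd s \<longleftrightarrow> (\<forall>j<length ls. \<forall>b<k. s j b = 0 \<or> s j b = L b)" for s :: "nat \<Rightarrow> nat \<Rightarrow> nat"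
  have X: "length Ss = length ls" "j < length ls \<Longrightarrow> Ss ! j \<subseteq> {..<N}" if "Ss \<in> X" for Ss j
    using that by (auto simp: X_def e_choices_def)
  have "psum_coeff (e_coeff N \<mu>) = (\<Sum>Ss\<in>e_choices ls. weight (occurrences Ss))"
  proof (rule psum_coeff_card[OF finite_e_choices])
    show "occurrences Ss i \<le> N" if "Ss \<in> e_choices ls" for Ss i
    proof -
      have "occurrences Ss i \<le> card {..<length Ss}" unfolding occurrences_def by (rule card_mono) auto
      then show ?thesis using that len by (simp add: e_choices_def ls_def)
    qed
    show "e_coeff N \<mu> \<alpha> = card {Ss \<in> e_choices ls. \<forall>i<N. occurrences Ss i = \<alpha> i}" for \<alpha>
      unfolding e_coeff_def Let_def e_choices_def ls_def[symmetric] occurrences_def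
      by (rule arg_cong[where f = card]) auto
  qed
  also have "\<dots> = (\<Sum>Ss\<in>X. w Ss)"
  proof -
    have "weight (occurrences Ss) = (if Ss \<in> X then w Ss else 0)" if "Ss \<in> e_choices ls" for Ss
      using that prod_occurrences[of Ss] by (auto simp: weight_def sum_occurrences X_def sh_def w_def e_choices_def)
    moreover have "{x \<in> e_choices ls. x \<in> X} = X" by (auto simp: X_def)
    ultimately show ?thesis
      using finite_e_choices[of ls] by (simp add: sum.inter_filter[symmetric])
  qed
  also have "\<dots> = (\<Sum>Ss\<in>{Ss \<in> X. gd (sh Ss)}. w Ss)"
  proof -
    \<comment> \<open>The pair to rotate is chosen from the intersection sizes alone. Rotation
      preserves these, so the same pair is chosen afterwards.\<close>
    define jb where "jb s = (SOME (j, b). j < length ls \<and> b < k \<and> s j b \<noteq> 0 \<and> s j b \<noteq> L b)"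
      for s :: "nat \<Rightarrow> nat \<Rightarrow> nat"
    have jb: "fst (jb s) < length ls" "snd (jb s) < k" "s (fst (jb s)) (snd (jb s)) \<noteq> 0"
      "s (fst (jb s)) (snd (jb s)) \<noteq> L (snd (jb s))" if "\<not> gd s" for s
    proof -
      have "\<exists>x. case x of (j, b) \<Rightarrow> j < length ls \<and> b < k \<and> s j b \<noteq> 0 \<and> s j b \<noteq> L b"
        using that by (auto simp: gd_def)
      then have "case jb s of (j, b) \<Rightarrow> j < length ls \<and> b < k \<and> s j b \<noteq> 0 \<and> s j b \<noteq> L b"
        unfolding jb_def by (rule someI_ex)
      then show "fst (jb s) < length ls" "snd (jb s) < k" "s (fst (jb s)) (snd (jb s)) \<noteq> 0"
        "s (fst (jb s)) (snd (jb s)) \<noteq> L (snd (jb s))" by (auto split: prod.splits)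
    qed
    define \<rho> where "\<rho> Ss = rotate_in (fst (jb (sh Ss))) (snd (jb (sh Ss))) Ss" for Ss
    define \<xi> where "\<xi> Ss = \<omega> (snd (jb (sh Ss))) ^ sh Ss (fst (jb (sh Ss))) (snd (jb (sh Ss)))" for Ss
    have nth: "rotate_in j b Ss ! j' = (if j' = j then (Ss ! j - block b) \<union> r ` (Ss ! j \<inter> block b) else Ss ! j')"
      if "j < length Ss" for j b Ss j' using that by (auto simp: rotate_in_def nth_list_update)
    have sh_\<rho>: "sh (\<rho> Ss) j b = sh Ss j b" if "Ss \<in> X" "\<not> gd (sh Ss)" for Ss j b
      using X[OF that(1)] jb[OF that(2)] unfolding sh_def[of _ j] \<rho>_def
      by (subst nth) (auto simp: card_rotated_Int)
    then have sh_eq: "sh (\<rho> Ss) = sh Ss" if "Ss \<in> X" "\<not> gd (sh Ss)" for Ss using that by blast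
    show ?thesis
    proof (rule sum_split_rotated[where \<rho> = \<rho> and \<xi> = \<xi>])
      show "finite X" using finite_e_choices by (simp add: X_def)
      fix Ss assume Ss: "Ss \<in> X" "\<not> gd (sh Ss)"
      note XS = X[OF Ss(1)] and j = jb[OF Ss(2)]
      have "\<rho> Ss \<in> e_choices ls"
        using Ss XS j unfolding \<rho>_def e_choices_def X_def
        by (auto simp: nth card_rotated split: if_splits)
          (auto simp: rotate_in_def dest: r_less)
      then show "\<rho> Ss \<in> X \<and> \<not> gd (sh (\<rho> Ss))"
        using Ss sh_eq[OF Ss] by (simp add: X_def)
      have "w (\<rho> Ss) = (\<Prod>j'<length ls. (if j' = fst (jb (sh Ss)) then \<xi> Ss else 1) * (\<Prod>i\<in>Ss ! j'. z i))"
        unfolding w_def using XS j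
        by (intro prod.cong refl) (auto simp: \<rho>_def \<xi>_def nth sh_def[of _ "fst _"] prod_rotated)
      also have "\<dots> = \<xi> Ss * w Ss"
        unfolding prod.distrib w_def using j(1) by (simp add: prod.delta)
      finally show "w (\<rho> Ss) = \<xi> Ss * w Ss" .
      have "card (Ss ! fst (jb (sh Ss)) \<inter> block (snd (jb (sh Ss)))) \<le> L (snd (jb (sh Ss)))"
        using card_mono[OF finite_block] card_block[OF j(2)] by (metis inf_le2)
      then have "\<xi> Ss \<noteq> 1" using j unfolding \<xi>_def
        by (intro rot_pow) (auto simp: sh_def)
      then show "\<xi> (\<rho> Ss) = \<xi> Ss \<and> \<xi> Ss \<noteq> 1"
        using sh_eq[OF Ss] by (simp add: \<xi>_def)
    next
      show "inj_on \<rho> {Ss \<in> X. \<not> gd (sh Ss)}"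
      proof (rule inj_onI)
        fix Ss Ss' assume Ss: "Ss \<in> {Ss \<in> X. \<not> gd (sh Ss)}" and Ss': "Ss' \<in> {Ss \<in> X. \<not> gd (sh Ss)}"
          and eq: "\<rho> Ss = \<rho> Ss'"
        \<comment> \<open>Equal images have equal intersection sizes, so the same pair was rotated
          in both and injectivity reduces to a single set.\<close>
        have sh: "sh Ss = sh Ss'" using sh_eq Ss Ss' eq by (metis (mono_tags, lifting) mem_Collect_eq)
        have len: "length Ss = length ls" "length Ss' = length ls" using X Ss Ss' by auto
        show "Ss = Ss'"
        proof (rule nth_equalityI)
          fix j assume j: "j < length Ss"
          have "\<rho> Ss ! j = \<rho> Ss' ! j" by (simp add: eq)
          moreover have "Ss ! j \<subseteq> {..<N}" "Ss' ! j \<subseteq> {..<N}" using X Ss Ss' j len by auto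
          ultimately show "Ss ! j = Ss' ! j"
            using jb[of "sh Ss'"] Ss' len unfolding \<rho>_def sh
            by (auto simp: nth split: if_splits dest: rotated_inj)
        qed (simp add: len)
      qed
    qed
  qed
  also have "{Ss \<in> X. gd (sh Ss)} = e_good ls"
    by (auto simp: X_def gd_def e_good_def sh_def)
  also have "(\<Sum>Ss\<in>e_good ls. w Ss) = (\<Sum>Ss\<in>e_good ls. root_prod)"
  proof (rule sum.cong[OF refl])
    fix Ss assume Ss: "Ss \<in> e_good ls"
    then have S: "length Ss = length ls" "\<forall>j<length Ss. Ss ! j \<subseteq> {..<N}"
      by (auto simp: e_good_def e_choices_def)
    have "occurrences Ss i = 1" if i: "i < N" for i
    proof -
      define b where "b = blk i"
      have b: "b < k" "i \<in> block b" using i by (auto simp: b_def blk_less block_def)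
      define J where "J = {j. j < length ls \<and> i \<in> Ss ! j}"
      \<comment> \<open>A set containing \<open>i\<close> must contain its whole block, and a set
        missing \<open>i\<close> must miss the block entirely.\<close>
      have c: "card (Ss ! j \<inter> block b) = (if j \<in> J then L b else 0)" if j: "j < length ls" for j
      proof -
        have *: "card (Ss ! j \<inter> block b) = 0 \<or> card (Ss ! j \<inter> block b) = L b"
          using Ss j b by (auto simp: e_good_def)
        show ?thesis
        proof (cases "j \<in> J")
          case True
          then have "card (Ss ! j \<inter> block b) \<noteq> 0" using b by (auto simp: J_def)
          then show ?thesis using * True by auto
        next
          case False
          then have "Ss ! j \<inter> block b \<subset> block b" using b j by (auto simp: J_def)
          then have "card (Ss ! j \<inter> block b) < L b"
            using psubset_card_mono[OF finite_block] card_block[OF b(1)] by metis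
          then show ?thesis using * False by auto
        qed
      qed
      have "L b = (\<Sum>j<length ls. card (Ss ! j \<inter> block b))" using Ss b by (auto simp: e_good_def)
      also have "\<dots> = (\<Sum>j<length ls. if j \<in> J then L b else 0)" using c by simp
      also have "\<dots> = card J * L b"
        by (simp add: sum.If_cases) (auto simp: J_def intro!: arg_cong[where f = card])
      finally have "card J = 1" using L_pos[OF b(1)] by simp
      then show ?thesis by (simp add: occurrences_def J_def S)
    qed
    then have "(\<Prod>i<N. z i ^ occurrences Ss i) = root_prod" by (simp add: root_prod_def)
    then show "w Ss = root_prod" using prod_occurrences[OF S(2)] S(1) by (simp add: w_def)
  qed
  also have "\<dots> = root_prod * of_nat (card (e_good ls))" by simp
  finally show ?thesis by (simp add: ls_def)
qed

end

section \<open>Existence of the root blocks\<close>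

text \<open>Variables are indexed by pairs \<open>(b, s)\<close> with \<open>s < L b\<close> and
  sent to the \<open>s\<close>-th power of a primitive \<open>L b\<close>-th root of unity;
  \<open>r\<close> increases \<open>s\<close> cyclically.\<close>

lemma ex_root_blocks:
  assumes L: "\<And>b. b < k \<Longrightarrow> 0 < L b"
  shows "\<exists>blk r z \<omega>. root_blocks (\<Sum>b<k. L b) k L blk r z \<omega>"
proof -
  define N where "N = (\<Sum>b<k. L b)"
  define S where "S = (SIGMA b:{..<k}. {..<L b})"
  have "card S = card {..<N}" by (simp add: S_def N_def)
  moreover have "finite S" by (simp add: S_def)
  ultimately obtain h where h: "bij_betw h {..<N} S"
    using finite_same_card_bij[of "{..<N}" S] by auto
  define g where "g = inv_into {..<N} h"
  define \<omega> where "\<omega> b = cis (2 * pi / real (L b))" for b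
  define next_root where "next_root = (\<lambda>(b, s). (b, (s + 1) mod L b))"
  have hS: "h i \<in> S" if "i < N" for i using h that by (auto simp: bij_betw_def)
  have hN: "fst (h i) < k" "snd (h i) < L (fst (h i))" if "i < N" for i
    using hS[OF that] by (auto simp: S_def)
  have g: "g x < N" "h (g x) = x" if "x \<in> S" for x
    using bij_betw_inv_into_right[OF h that] bij_betwE[OF bij_betw_inv_into[OF h]] that
    by (auto simp: g_def)
  have nS: "next_root x \<in> S" if "x \<in> S" for x
    using that by (auto simp: S_def next_root_def L)
  have pow1: "\<omega> b ^ L b = 1" if "b < k" for b
    using L[OF that] by (simp add: \<omega>_def DeMoivre)
  have pow_mod: "\<omega> b ^ (s mod L b) = \<omega> b ^ s" if "b < k" for b s
  proof -
    have "\<omega> b ^ s = \<omega> b ^ (L b * (s div L b) + s mod L b)" by simp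
    also have "\<dots> = \<omega> b ^ (s mod L b)"
      unfolding power_add power_mult pow1[OF that] by simp
    finally show ?thesis by simp
  qed
  have "root_blocks N k L (fst \<circ> h) (g \<circ> next_root \<circ> h) (\<lambda>i. \<omega> (fst (h i)) ^ snd (h i)) \<omega>"
  proof
    fix i assume i: "i < N"
    show "(fst \<circ> h) i < k" using hN i by simp
    show "(g \<circ> next_root \<circ> h) i < N" using g nS hS i by simp
    show "(fst \<circ> h) ((g \<circ> next_root \<circ> h) i) = (fst \<circ> h) i"
      using g(2)[OF nS[OF hS[OF i]]] by (simp add: next_root_def split: prod.splits)
    show "\<omega> (fst (h ((g \<circ> next_root \<circ> h) i))) ^ snd (h ((g \<circ> next_root \<circ> h) i)) =
        \<omega> ((fst \<circ> h) i) * \<omega> (fst (h i)) ^ snd (h i)"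
      using g(2)[OF nS[OF hS[OF i]]] pow_mod[OF hN(1)[OF i], of "Suc (snd (h i))"]
      by (simp add: next_root_def split: prod.splits)
    show "(\<omega> (fst (h i)) ^ snd (h i)) ^ L ((fst \<circ> h) i) = 1"
      using pow1[OF hN(1)[OF i]] by (metis comp_apply mult.commute power_mult power_one)
  next
    have "inj_on next_root S"
    proof (rule inj_onI)
      fix x y assume "x \<in> S" "y \<in> S" "next_root x = next_root y"
      moreover have "s = t" if "s < l" "t < l" "Suc s mod l = Suc t mod l" for s t l :: nat
        using that by (auto simp: mod_Suc split: if_splits)
      ultimately show "x = y" by (auto simp: next_root_def S_def)
    qed
    moreover have "inj_on g S" using g(2) by (metis inj_on_inverseI)
    moreover have "inj_on h {..<N}" "h ` {..<N} = S" using h by (auto simp: bij_betw_def)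
    ultimately show "inj_on (g \<circ> next_root \<circ> h) {..<N}"
      using nS by (metis (no_types, lifting) comp_inj_on image_subsetI inj_on_subset)
  next
    fix b m assume b: "b < k" and m: "0 < m" "m < L b"
    show "\<omega> b ^ m \<noteq> 1"
    proof
      let ?f = "\<lambda>j. cis (2 * pi * real j / real (L b))"
      assume "\<omega> b ^ m = 1"
      then have "?f m = ?f 0" by (simp add: \<omega>_def DeMoivre mult.commute)
      moreover have "inj_on ?f {..<L b}"
        using bij_betw_roots_unity[OF L[OF b]] by (simp add: bij_betw_def)
      ultimately have "m = 0" using m by (auto simp only: inj_on_def lessThan_iff)
      then show False using m by simp
    qed
  next
    fix b assume b: "b < k"
    show "0 < L b" using L[OF b] .
    have "bij_betw h {i. i < N \<and> (fst \<circ> h) i = b} ({b} \<times> {..<L b})"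
    proof (rule bij_betw_subset[OF h])
      show "h ` {i. i < N \<and> (fst \<circ> h) i = b} = {b} \<times> {..<L b}"
      proof
        show "h ` {i. i < N \<and> (fst \<circ> h) i = b} \<subseteq> {b} \<times> {..<L b}"
          using hN(2) by (intro image_subsetI) (auto simp: mem_Times_iff)
        show "{b} \<times> {..<L b} \<subseteq> h ` {i. i < N \<and> (fst \<circ> h) i = b}"
        proof
          fix x assume x: "x \<in> {b} \<times> {..<L b}"
          then have "x \<in> S" using b by (auto simp: S_def)
          then show "x \<in> h ` {i. i < N \<and> (fst \<circ> h) i = b}"
            using g[of x] x by (intro image_eqI[of _ _ "g x"]) auto
        qed
      qed
    qed auto
    then show "card {i. i < N \<and> (fst \<circ> h) i = b} = L b"
      using bij_betw_same_card by fastforce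
  qed
  then show ?thesis unfolding N_def by blast
qed

section \<open>Trees and chromatic symmetric functions\<close>

text \<open>Trees in a form suited to induction on leaves: each new vertex has exactly one neighbour
  among those already present.\<close>

inductive leaf_built :: "('a \<Rightarrow> 'a \<Rightarrow> bool) \<Rightarrow> 'a set \<Rightarrow> bool" for E where
  single: "leaf_built E {v}"
| attach: "leaf_built E A \<Longrightarrow> v \<notin> A \<Longrightarrow> u \<in> A \<Longrightarrow> (\<And>w. w \<in> A \<Longrightarrow> E v w \<longleftrightarrow> w = u) \<Longrightarrow>
    leaf_built E (insert v A)"

lemma leaf_built_finite: "leaf_built E A \<Longrightarrow> finite A"
  by (induction rule: leaf_built.induct) auto

context root_blocks
begin

definition colourings :: "('a \<Rightarrow> 'a \<Rightarrow> bool) \<Rightarrow> 'a set \<Rightarrow> ('a \<Rightarrow> nat) set" where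
  "colourings E V = {\<kappa> \<in> V \<rightarrow>\<^sub>E {..<N}. \<forall>u\<in>V. \<forall>v\<in>V. E u v \<longrightarrow> \<kappa> u \<noteq> \<kappa> v}"

text \<open>The degree condition of \<open>weight\<close>, expressed for the content of a
  colouring.\<close>

definition balanced :: "'a set \<Rightarrow> ('a \<Rightarrow> nat) \<Rightarrow> bool" where
  "balanced V \<kappa> \<longleftrightarrow> (\<forall>b<k. card {v \<in> V. blk (\<kappa> v) = b} = L b)"

lemma finite_colourings: "finite V \<Longrightarrow> finite (colourings E V)"
  unfolding colourings_def by (rule finite_subset[of _ "V \<rightarrow>\<^sub>E {..<N}"]) (auto simp: finite_PiE)

lemma colourings_less: "\<kappa> \<in> colourings E V \<Longrightarrow> v \<in> V \<Longrightarrow> \<kappa> v < N"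
  by (auto simp: colourings_def)

lemma psum_coeff_chrom:
  assumes V: "finite V" "card V \<le> N"
  shows "psum_coeff (chrom_coeff V E N) = (\<Sum>\<kappa>\<in>{\<kappa> \<in> colourings E V. balanced V \<kappa>}. \<Prod>v\<in>V. z (\<kappa> v))"
proof -
  let ?cont = "\<lambda>\<kappa> i. card {v \<in> V. \<kappa> v = i}"
  have "psum_coeff (chrom_coeff V E N) = (\<Sum>\<kappa>\<in>colourings E V. weight (?cont \<kappa>))"
  proof (rule psum_coeff_card[OF finite_colourings[OF V(1)]])
    show "?cont \<kappa> i \<le> N" for \<kappa> i
      using card_mono[OF V(1), of "{v \<in> V. \<kappa> v = i}"] V(2) by auto
    show "chrom_coeff V E N \<alpha> = card {\<kappa> \<in> colourings E V. \<forall>i<N. ?cont \<kappa> i = \<alpha> i}" for \<alpha>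
      unfolding chrom_coeff_def colourings_def by (rule arg_cong[where f = card]) auto
  qed
  also have "\<dots> = (\<Sum>\<kappa>\<in>colourings E V. if balanced V \<kappa> then \<Prod>v\<in>V. z (\<kappa> v) else 0)"
  proof (rule sum.cong[OF refl])
    fix \<kappa> assume \<kappa>: "\<kappa> \<in> colourings E V"
    have "(\<Sum>i\<in>block b. ?cont \<kappa> i) = card {v \<in> V. blk (\<kappa> v) = b}" for b
    proof -
      let ?B = "{v \<in> V. blk (\<kappa> v) = b}"
      have "?cont \<kappa> i = (\<Sum>v\<in>{v \<in> ?B. \<kappa> v = i}. 1)" if "i \<in> block b" for i
        using that by (auto simp: block_def intro!: arg_cong[where f = card])
      then have "(\<Sum>i\<in>block b. ?cont \<kappa> i) = (\<Sum>i\<in>block b. \<Sum>v\<in>{v \<in> ?B. \<kappa> v = i}. 1)" by simp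
      also have "\<dots> = (\<Sum>v\<in>?B. 1)"
        using V(1) colourings_less[OF \<kappa>] by (intro sum.group) (auto simp: block_def)
      finally show ?thesis by simp
    qed
    moreover have "(\<Prod>i<N. z i ^ ?cont \<kappa> i) = (\<Prod>v\<in>V. z (\<kappa> v))"
    proof -
      have "(\<Prod>i<N. z i ^ ?cont \<kappa> i) = (\<Prod>i<N. \<Prod>v\<in>{v \<in> V. \<kappa> v = i}. z (\<kappa> v))" by simp
      also have "\<dots> = (\<Prod>v\<in>V. z (\<kappa> v))"
        using V(1) colourings_less[OF \<kappa>] by (intro prod.group) auto
      finally show ?thesis .
    qed
    ultimately show "weight (?cont \<kappa>) = (if balanced V \<kappa> then \<Prod>v\<in>V. z (\<kappa> v) else 0)"
      unfolding weight_def balanced_def by (simp only:)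
  qed
  also have "\<dots> = (\<Sum>\<kappa>\<in>{\<kappa> \<in> colourings E V. balanced V \<kappa>}. \<Prod>v\<in>V. z (\<kappa> v))"
    by (rule sum.inter_filter[symmetric]) (rule finite_colourings[OF V(1)])
  finally show ?thesis .
qed

text \<open>The preimages of the colour blocks serve as \<open>P\<close>; their positive sizes make
  them distinct, so no size is lost in the type.\<close>

lemma balanced_partition_type:
  assumes V: "finite V" and \<kappa>: "\<kappa> \<in> colourings E V" "balanced V \<kappa>"
    and conn: "\<And>b. b < k \<Longrightarrow> connected_set E {v \<in> V. blk (\<kappa> v) = b}"
  shows "\<exists>P. connected_partition V E P \<and> partition_type P = image_mset L (mset_set {..<k})"
proof -
  define B where "B b = {v \<in> V. blk (\<kappa> v) = b}" for b
  have card: "card (B b) = L b" if "b < k" for b using \<kappa>(2) that by (simp add: balanced_def B_def)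
  have "inj_on B {..<k}"
  proof (rule inj_onI)
    fix b c assume "b \<in> {..<k}" "B b = B c"
    moreover from this obtain v where "v \<in> B b" using card[of b] L_pos[of b] by fastforce
    ultimately show "b = c" by (auto simp: B_def)
  qed
  then have "mset_set (B ` {..<k}) = image_mset B (mset_set {..<k})"
    by (rule image_mset_mset_set[symmetric])
  then have "partition_type (B ` {..<k}) = image_mset (\<lambda>b. card (B b)) (mset_set {..<k})"
    by (simp add: partition_type_def multiset.map_comp comp_def)
  also have "\<dots> = image_mset L (mset_set {..<k})" by (rule image_mset_cong) (simp add: card)
  finally have type: "partition_type (B ` {..<k}) = image_mset L (mset_set {..<k})" .
  have "\<Union>(B ` {..<k}) = V" using colourings_less[OF \<kappa>(1)] blk_less by (auto simp: B_def)
  then have "connected_partition V E (B ` {..<k})"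
    using conn by (auto simp: connected_partition_def B_def)
  then show ?thesis using type by blast
qed

text \<open>\<open>C\<close> is what can be reached inside \<open>B\<close> from a vertex that does
  not reach all of \<open>B\<close>.\<close>

lemma disconnected_split:
  assumes sym: "\<And>u v. E u v \<Longrightarrow> E v u" and B: "B \<noteq> {}" "\<not> connected_set E B"
  shows "\<exists>C. C \<subseteq> B \<and> C \<noteq> {} \<and> C \<noteq> B \<and> (\<forall>u\<in>C. \<forall>v\<in>B - C. \<not> E u v \<and> \<not> E v u)"
proof -
  let ?R = "\<lambda>u v. u \<in> B \<and> v \<in> B \<and> E u v"
  obtain x y where xy: "x \<in> B" "y \<in> B" "\<not> ?R\<^sup>*\<^sup>* x y" using B unfolding connected_set_def by blast
  define C where "C = {v \<in> B. ?R\<^sup>*\<^sup>* x v}"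
  have "v \<in> C" if "u \<in> C" "v \<in> B" "E u v" for u v
  proof -
    have "?R\<^sup>*\<^sup>* x u" "?R u v" using that by (simp_all add: C_def)
    then have "?R\<^sup>*\<^sup>* x v" by (rule rtranclp.rtrancl_into_rtrancl)
    then show ?thesis using that by (simp add: C_def)
  qed
  then have "\<forall>u\<in>C. \<forall>v\<in>B - C. \<not> E u v \<and> \<not> E v u" using sym by blast
  moreover have "x \<in> C" "y \<notin> C" "C \<subseteq> B" using xy by (simp_all add: C_def)
  ultimately show ?thesis using xy(2) by blast
qed

text \<open>Rotating the colours on a union of components of a block, chosen as a function of the blocks
  alone, multiplies the weight by a root of unity other than 1.\<close>
lemma psum_coeff_chrom_eq_0:
  assumes V: "finite V" "card V \<le> N" and sym: "\<And>u v. E u v \<Longrightarrow> E v u"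
    and missing: "\<nexists>P. connected_partition V E P \<and> partition_type P = image_mset L (mset_set {..<k})"
  shows "psum_coeff (chrom_coeff V E N) = 0"
proof -
  define B where "B \<kappa> b = {v \<in> V. blk (\<kappa> v) = b}" for \<kappa> :: "'a \<Rightarrow> nat" and b
  define split where "split F b C \<longleftrightarrow> b < k \<and> C \<subseteq> F b \<and> C \<noteq> {} \<and> C \<noteq> F b \<and>
    (\<forall>u\<in>C. \<forall>v\<in>F b - C. \<not> E u v \<and> \<not> E v u)" for F :: "nat \<Rightarrow> 'a set" and b C
  define bC where "bC F = (SOME x. split F (fst x) (snd x))" for F
  define X where "X = {\<kappa> \<in> colourings E V. balanced V \<kappa>}"
  define bb where "bb \<kappa> = fst (bC (B \<kappa>))" for \<kappa>
  define C where "C \<kappa> = snd (bC (B \<kappa>))" for \<kappa>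
  have split: "split (B \<kappa>) (bb \<kappa>) (C \<kappa>)" if "\<kappa> \<in> X" for \<kappa>
  proof -
    have \<kappa>: "\<kappa> \<in> colourings E V" "balanced V \<kappa>" using that by (auto simp: X_def)
    obtain b where b: "b < k" "\<not> connected_set E (B \<kappa> b)"
      using balanced_partition_type[OF V(1) \<kappa>] missing unfolding B_def by blast
    have "card (B \<kappa> b) = L b" using \<kappa>(2) b by (simp add: balanced_def B_def)
    then have "B \<kappa> b \<noteq> {}" using L_pos[OF b(1)] by auto
    then obtain D where "split (B \<kappa>) b D"
      using disconnected_split[where E = E, OF sym] b unfolding split_def by meson
    then have "\<exists>x. split (B \<kappa>) (fst x) (snd x)" by auto
    then show ?thesis unfolding bb_def C_def bC_def by (rule someI_ex)
  qed
  define \<rho> where "\<rho> \<kappa> = (\<lambda>v. if v \<in> C \<kappa> then r (\<kappa> v) else \<kappa> v)" for \<kappa> :: "'a \<Rightarrow> nat"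
  define \<xi> where "\<xi> \<kappa> = \<omega> (bb \<kappa>) ^ card (C \<kappa>)" for \<kappa>
  have CV: "C \<kappa> \<subseteq> V" "\<And>v. v \<in> C \<kappa> \<Longrightarrow> blk (\<kappa> v) = bb \<kappa>" if "\<kappa> \<in> X" for \<kappa>
    using split[OF that] by (auto simp: split_def B_def)
  have less: "\<kappa> v < N" if "\<kappa> \<in> X" "v \<in> V" for \<kappa> v
    using that colourings_less by (auto simp: X_def)
  have blk: "blk (\<rho> \<kappa> v) = blk (\<kappa> v)" if "\<kappa> \<in> X" "v \<in> V" for \<kappa> v
    using blk_r[OF less[OF that]] by (simp add: \<rho>_def)
  then have B: "B (\<rho> \<kappa>) = B \<kappa>" if "\<kappa> \<in> X" for \<kappa>
    using that by (auto simp: B_def fun_eq_iff)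
  have "(\<Sum>\<kappa>\<in>X. \<Prod>v\<in>V. z (\<kappa> v)) = 0"
  proof (rule sum_eq_0_if_rotated[where \<rho> = \<rho> and \<xi> = \<xi>])
    show "finite X" unfolding X_def using finite_colourings[OF V(1)] by simp
  next
    fix \<kappa> assume \<kappa>: "\<kappa> \<in> X"
    \<comment> \<open>An edge with exactly one end in \<open>C \<kappa>\<close> joins vertices of
      different colour blocks, which rotation keeps. On all other edges the injectivity of
      \<open>r\<close> suffices.\<close>
    have "\<rho> \<kappa> u \<noteq> \<rho> \<kappa> v" if uv: "u \<in> V" "v \<in> V" "E u v" for u v
    proof -
      have ne: "\<kappa> u \<noteq> \<kappa> v" using \<kappa> uv by (auto simp: X_def colourings_def)
      have cross: "blk (\<kappa> v) \<noteq> blk (\<kappa> u)" if "(u \<in> C \<kappa>) \<noteq> (v \<in> C \<kappa>)"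
        using that split[OF \<kappa>] uv unfolding split_def B_def by auto
      show ?thesis
      proof (cases "(u \<in> C \<kappa>) = (v \<in> C \<kappa>)")
        case True
        then show ?thesis using ne inj_onD[OF inj_r, of "\<kappa> u" "\<kappa> v"] less[OF \<kappa>] uv
          by (auto simp: \<rho>_def)
      next
        case False
        then show ?thesis using cross blk[OF \<kappa>] uv by metis
      qed
    qed
    moreover have "\<rho> \<kappa> \<in> V \<rightarrow>\<^sub>E {..<N}"
    proof (rule PiE_I)
      show "\<rho> \<kappa> v \<in> {..<N}" if "v \<in> V" for v
        using less[OF \<kappa> that] r_less by (simp add: \<rho>_def)
      show "\<rho> \<kappa> v = undefined" if "v \<notin> V" for v
        using \<kappa> CV(1)[OF \<kappa>] that by (auto simp: X_def colourings_def \<rho>_def PiE_def extensional_def)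
    qed
    moreover have "balanced V (\<rho> \<kappa>)"
      using \<kappa> fun_cong[OF B[OF \<kappa>]] unfolding X_def balanced_def B_def by simp
    ultimately show "\<rho> \<kappa> \<in> X" by (auto simp: X_def colourings_def)
    have "(\<Prod>v\<in>V. z (\<rho> \<kappa> v)) = (\<Prod>v\<in>V. (if v \<in> C \<kappa> then \<omega> (bb \<kappa>) else 1) * z (\<kappa> v))"
      using z_r less[OF \<kappa>] CV[OF \<kappa>] by (intro prod.cong refl) (auto simp: \<rho>_def)
    also have "\<dots> = \<xi> \<kappa> * (\<Prod>v\<in>V. z (\<kappa> v))"
      using V(1) CV(1)[OF \<kappa>] by (simp add: prod.distrib prod.If_cases Int_absorb1 \<xi>_def)
    finally show "(\<Prod>v\<in>V. z (\<rho> \<kappa> v)) = \<xi> \<kappa> * (\<Prod>v\<in>V. z (\<kappa> v))" .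
    show "\<xi> (\<rho> \<kappa>) = \<xi> \<kappa>" using B[OF \<kappa>] by (simp add: \<xi>_def bb_def C_def)
    \<comment> \<open>Being a nonempty proper part of its block, \<open>C \<kappa>\<close> gives
      \<open>\<xi>\<close> an exponent strictly between 0 and
      \<open>L (bb \<kappa>)\<close>.\<close>
    have "finite (B \<kappa> (bb \<kappa>))" using V by (simp add: B_def)
    moreover have "C \<kappa> \<subset> B \<kappa> (bb \<kappa>)" "C \<kappa> \<noteq> {}" and b: "bb \<kappa> < k"
      using split[OF \<kappa>] by (auto simp: split_def)
    moreover have "card (B \<kappa> (bb \<kappa>)) = L (bb \<kappa>)"
      using \<kappa> b by (simp add: X_def balanced_def B_def)
    ultimately have "0 < card (C \<kappa>)" "card (C \<kappa>) < L (bb \<kappa>)"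
      using psubset_card_mono[of "B \<kappa> (bb \<kappa>)" "C \<kappa>"] by (auto simp: card_gt_0_iff intro: finite_subset)
    then show "\<xi> \<kappa> \<noteq> 1" unfolding \<xi>_def by (rule rot_pow[OF b])
  next
    show "inj_on \<rho> X"
    proof (rule inj_onI)
      fix \<kappa> \<kappa>' assume \<kappa>: "\<kappa> \<in> X" "\<kappa>' \<in> X" and eq: "\<rho> \<kappa> = \<rho> \<kappa>'"
      have C: "C \<kappa> = C \<kappa>'" using B[OF \<kappa>(1)] B[OF \<kappa>(2)] eq by (simp add: C_def)
      show "\<kappa> = \<kappa>'"
      proof
        fix v
        show "\<kappa> v = \<kappa>' v"
          using fun_cong[OF eq, of v] CV(1)[OF \<kappa>(1)] less[OF \<kappa>(1)] less[OF \<kappa>(2)] C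
            inj_onD[OF inj_r, of "\<kappa> v" "\<kappa>' v"]
          by (auto simp: \<rho>_def split: if_splits)
      qed
    qed
  qed
  then show ?thesis using psum_coeff_chrom[OF V] by (simp add: X_def)
qed

section \<open>The coefficient of the full power sum for trees\<close>

text \<open>With a single block, rotation multiplies every summand by \<open>\<omega> 0 ^ m\<close>,
  which is not 1 in this range.\<close>

lemma sum_root_powers:
  assumes "k = 1" "0 < m" "m < N"
  shows "(\<Sum>c<N. z c ^ m) = 0"
proof (rule sum_eq_0_if_rotated[where \<rho> = r and \<xi> = "\<lambda>_. \<omega> 0 ^ m"])
  show "\<omega> 0 ^ m \<noteq> 1" using rot_pow[of 0 m] single_block assms by simp
  show "z (r x) ^ m = \<omega> 0 ^ m * z x ^ m" if "x \<in> {..<N}" for x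
    using that blk_eq_0[OF assms(1)] z_r by (simp add: power_mult_distrib)
qed (use r_less inj_r in auto)

text \<open>Summing over the colours of a leaf \<open>v\<close>, all but that of its neighbour
  \<open>u\<close>, gives minus the missing term. Thus the weight of \<open>v\<close> moves to
  \<open>u\<close> and the sign flips. At a single vertex of weight \<open>N\<close> every term is
  1, and the sum counts colourings.\<close>

lemma leaf_built_weighted_sum:
  assumes "leaf_built E A" and k: "k = 1" and sym: "\<And>u v. E u v \<Longrightarrow> E v u" and irr: "\<And>v. \<not> E v v"
    and "\<And>v. v \<in> A \<Longrightarrow> 0 < m v" "sum m A = N"
  shows "(\<Sum>\<kappa>\<in>colourings E A. \<Prod>v\<in>A. z (\<kappa> v) ^ m v) \<noteq> 0"
  using assms(1,5,6)
proof (induction arbitrary: m)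
  case (single v)
  note blk0 = blk_eq_0[OF k] and L0 = single_block[OF k]
  have "(\<Sum>\<kappa>\<in>colourings E {v}. \<Prod>u\<in>{v}. z (\<kappa> u) ^ m u) = (\<Sum>\<kappa>\<in>colourings E {v}. 1)"
  proof (rule sum.cong[OF refl])
    fix \<kappa> assume "\<kappa> \<in> colourings E {v}"
    then have "\<kappa> v < N" by (rule colourings_less) simp
    then show "(\<Prod>u\<in>{v}. z (\<kappa> u) ^ m u) = 1"
      using z_pow[of "\<kappa> v"] blk0 L0 single by simp
  qed
  \<comment> \<open>Colour 0 is available because \<open>N = m v\<close> is positive.\<close>
  moreover have "(\<lambda>u\<in>{v}. 0) \<in> colourings E {v}"
    using irr single by (auto simp: colourings_def)
  then have "card (colourings E {v}) \<noteq> 0" using finite_colourings[of "{v}" E] by auto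
  ultimately show ?case by simp
next
  case (attach A v u)
  let ?m = "m(u := m u + m v)"
  let ?w = "\<lambda>\<kappa>. \<Prod>w\<in>A. z (\<kappa> w) ^ m w"
  have fin: "finite A" using attach.hyps(1) by (rule leaf_built_finite)
  have "0 < m u" "m u \<le> sum m A" using attach.prems(1) attach.hyps fin
    by (auto intro: member_le_sum)
  \<comment> \<open>The positive weight of \<open>u\<close> keeps \<open>m v\<close> below
    \<open>N\<close>, so the sum of \<open>z c ^ m v\<close> over all colours vanishes.\<close>
  then have mv: "0 < m v" "m v < N" using attach.prems attach.hyps(2) fin by auto
  have "(\<Sum>\<kappa>\<in>colourings E (insert v A). \<Prod>w\<in>insert v A. z (\<kappa> w) ^ m w) =
      (\<Sum>(g, c)\<in>(SIGMA g:colourings E A. {..<N} - {g u}). z c ^ m v * ?w g)"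
  \<comment> \<open>A colouring of \<open>insert v A\<close> is a colouring \<open>g\<close> of
    \<open>A\<close> together with a colour of \<open>v\<close> different from
    \<open>g u\<close>.\<close>
  proof (rule sum.reindex_bij_witness[where i = "\<lambda>(g, c). g(v := c)" and j = "\<lambda>\<kappa>. (restrict \<kappa> A, \<kappa> v)"])
    fix \<kappa> assume \<kappa>: "\<kappa> \<in> colourings E (insert v A)"
    have ext: "\<kappa> w = undefined" if "w \<notin> insert v A" for w
      using \<kappa> that by (auto simp: colourings_def PiE_def extensional_def)
    show "(case (restrict \<kappa> A, \<kappa> v) of (g, c) \<Rightarrow> g(v := c)) = \<kappa>"
      using ext by (auto simp: fun_eq_iff)
    have "E v u" using attach.hyps by blast
    then show "(restrict \<kappa> A, \<kappa> v) \<in> (SIGMA g:colourings E A. {..<N} - {g u})"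
      using \<kappa> attach.hyps(3) by (auto simp: colourings_def)
    have "?w (restrict \<kappa> A) = ?w \<kappa>" by (intro prod.cong) auto
    then show "(case (restrict \<kappa> A, \<kappa> v) of (g, c) \<Rightarrow> z c ^ m v * ?w g) =
        (\<Prod>w\<in>insert v A. z (\<kappa> w) ^ m w)"
      using fin attach.hyps(2) by simp
  next
    fix x assume x: "x \<in> (SIGMA g:colourings E A. {..<N} - {g u})"
    obtain g c where gc: "x = (g, c)" "g \<in> colourings E A" "c < N" "c \<noteq> g u" using x by auto
    have ext: "g w = undefined" if "w \<notin> A" for w
      using gc(2) that by (auto simp: colourings_def PiE_def extensional_def)
    show "(restrict (case x of (g, c) \<Rightarrow> g(v := c)) A, (case x of (g, c) \<Rightarrow> g(v := c)) v) = x"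
      using gc ext attach.hyps(2) by (auto simp: fun_eq_iff)
    have "g(v := c) \<in> insert v A \<rightarrow>\<^sub>E {..<N}"
      using gc ext by (auto simp: colourings_def PiE_def extensional_def)
    moreover have "(g(v := c)) p \<noteq> (g(v := c)) q" if "p \<in> insert v A" "q \<in> insert v A" "E p q" for p q
      using that gc attach.hyps sym irr unfolding colourings_def by (auto split: if_splits)
    ultimately have "g(v := c) \<in> colourings E (insert v A)" unfolding colourings_def by blast
    then show "(case x of (g, c) \<Rightarrow> g(v := c)) \<in> colourings E (insert v A)"
      by (simp add: gc)
  qed
  also have "\<dots> = (\<Sum>g\<in>colourings E A. \<Sum>c\<in>{..<N} - {g u}. z c ^ m v * ?w g)"
    using finite_colourings[OF fin] by (subst sum.Sigma) auto
  also have "\<dots> = (\<Sum>g\<in>colourings E A. - (\<Prod>w\<in>A. z (g w) ^ ?m w))"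
  proof (rule sum.cong[OF refl])
    fix g assume "g \<in> colourings E A"
    then have "g u < N" using colourings_less attach.hyps(3) by metis
    then have "(\<Sum>c\<in>{..<N} - {g u}. z c ^ m v) = - (z (g u) ^ m v)"
      using sum_root_powers[OF k mv] by (simp add: sum_diff1)
    then have "(\<Sum>c\<in>{..<N} - {g u}. z c ^ m v * ?w g) = - (z (g u) ^ m v * ?w g)"
      by (simp flip: sum_distrib_right)
    also have "z (g u) ^ m v * ?w g = (\<Prod>w\<in>A. z (g w) ^ ?m w)"
      using prod.remove[OF fin attach.hyps(3), of "\<lambda>w. z (g w) ^ m w"]
        prod.remove[OF fin attach.hyps(3), of "\<lambda>w. z (g w) ^ ?m w"] by (simp add: power_add)
    finally show "(\<Sum>c\<in>{..<N} - {g u}. z c ^ m v * ?w g) = - (\<Prod>w\<in>A. z (g w) ^ ?m w)" .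
  qed
  also have "\<dots> = - (\<Sum>g\<in>colourings E A. \<Prod>w\<in>A. z (g w) ^ ?m w)" by (rule sum_negf)
  finally have "(\<Sum>\<kappa>\<in>colourings E (insert v A). \<Prod>w\<in>insert v A. z (\<kappa> w) ^ m w) =
      - (\<Sum>g\<in>colourings E A. \<Prod>w\<in>A. z (g w) ^ ?m w)" .
  moreover have "(\<Sum>g\<in>colourings E A. \<Prod>w\<in>A. z (g w) ^ ?m w) \<noteq> 0"
  proof (rule attach.IH)
    have "sum ?m A = (m u + m v) + sum m (A - {u})"
      using sum.remove[OF fin attach.hyps(3), of ?m] by simp
    also have "\<dots> = N" using sum.remove[OF fin attach.hyps(3), of m] attach.prems(2) attach.hyps(2) fin
      by simp
    finally show "sum ?m A = N" .
  qed (use attach.prems in auto)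
  ultimately show ?case by simp
qed

text \<open>With one block of size \<open>N\<close> every colouring is balanced, so the coefficient
  is the weighted sum with all weights 1.\<close>

lemma psum_coeff_chrom_tree:
  assumes V: "leaf_built E V" "card V = N" and k: "k = 1"
    and sym: "\<And>u v. E u v \<Longrightarrow> E v u" and irr: "\<And>v. \<not> E v v"
  shows "psum_coeff (chrom_coeff V E N) \<noteq> 0"
proof -
  note blk0 = blk_eq_0[OF k] and L0 = single_block[OF k]
  have "balanced V \<kappa>" if "\<kappa> \<in> colourings E V" for \<kappa>
  proof -
    have "{v \<in> V. blk (\<kappa> v) = 0} = V" using blk0 colourings_less[OF that] by auto
    then show ?thesis unfolding balanced_def using k L0 V(2) by simp
  qed
  then have "{\<kappa> \<in> colourings E V. balanced V \<kappa>} = colourings E V" by auto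
  then show ?thesis
    using psum_coeff_chrom[OF leaf_built_finite[OF V(1)], of E] V(2)
      leaf_built_weighted_sum[OF V(1) k sym irr, of "\<lambda>_. 1"] by simp
qed

end

section \<open>Positive expansions and connected partitions\<close>

lemma finite_int_partitions: "finite {\<mu>. int_partition n \<mu>}"
  and int_partition_size_le: "int_partition n \<mu> \<Longrightarrow> size \<mu> \<le> n"
proof -
  have size: "size \<mu> \<le> sum_mset \<mu>" if "\<forall>k\<in>#\<mu>. 0 < k" for \<mu> :: "nat multiset"
    using that by (induction \<mu>) auto
  have part: "k \<le> sum_mset \<mu>" if "k \<in># \<mu>" for k and \<mu> :: "nat multiset"
    using that by (auto dest!: multi_member_split)
  show "int_partition n \<mu> \<Longrightarrow> size \<mu> \<le> n" using size by (auto simp: int_partition_def)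
  have "{\<mu>. int_partition n \<mu>} \<subseteq> (\<Union>s\<le>n. multisets_of_size {..n} s)"
    using size part by (auto simp: int_partition_def multisets_of_size_def)
  then show "finite {\<mu>. int_partition n \<mu>}" by (rule finite_subset) auto
qed

lemma int_partition_containing_all:
  assumes "int_partition n \<mu>" "n \<in># \<mu>"
  shows "\<mu> = {#n#}"
proof -
  obtain \<nu> where \<nu>: "\<mu> = add_mset n \<nu>" using multi_member_split[OF assms(2)] by blast
  then have "sum_mset \<nu> = 0" "\<forall>k\<in>#\<nu>. 0 < k" using assms(1) by (auto simp: int_partition_def)
  then have "\<nu> = {#}" by (cases \<nu>) auto
  then show ?thesis using \<nu> by simp
qed

context root_blocks
begin

text \<open>By linearity. Once the common factor \<open>root_prod\<close> is pulled out, a real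
  number remains, in which nonnegative \<open>c\<close> allow no cancellation.\<close>

lemma psum_coeff_e_expansion:
  assumes f: "\<And>\<alpha>. real (f \<alpha>) = (\<Sum>\<mu>\<in>{\<mu>. int_partition N \<mu>}. c \<mu> * real (e_coeff N \<mu> \<alpha>))"
  shows "psum_coeff f = root_prod *
    of_real (\<Sum>\<mu>\<in>{\<mu>. int_partition N \<mu>}. c \<mu> * real (card (e_good (sorted_list_of_multiset \<mu>))))"
proof -
  let ?A = "{..<N} \<rightarrow>\<^sub>E {..N}" and ?P = "{\<mu>. int_partition N \<mu>}"
  have "of_nat (f \<alpha>) = (\<Sum>\<mu>\<in>?P. complex_of_real (c \<mu>) * of_nat (e_coeff N \<mu> \<alpha>))" for \<alpha>
    using arg_cong[OF f[of \<alpha>], of complex_of_real] by simp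
  then have "psum_coeff f =
      (\<Sum>\<alpha>\<in>?A. \<Sum>\<mu>\<in>?P. complex_of_real (c \<mu>) * (of_nat (e_coeff N \<mu> \<alpha>) * weight \<alpha>))"
    unfolding psum_coeff_def by (simp add: sum_distrib_right mult.assoc)
  also have "\<dots> = (\<Sum>\<mu>\<in>?P. complex_of_real (c \<mu>) * psum_coeff (e_coeff N \<mu>))"
    unfolding psum_coeff_def by (subst sum.swap) (simp add: sum_distrib_left)
  also have "\<dots> = (\<Sum>\<mu>\<in>?P. root_prod *
      of_real (c \<mu> * real (card (e_good (sorted_list_of_multiset \<mu>)))))"
  proof (rule sum.cong[OF refl])
    fix \<mu> assume "\<mu> \<in> ?P"
    then have "size \<mu> \<le> N" using int_partition_size_le by simp
    then have "length (sorted_list_of_multiset \<mu>) \<le> N"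
      by (metis mset_sorted_list_of_multiset size_mset)
    then show "complex_of_real (c \<mu>) * psum_coeff (e_coeff N \<mu>) = root_prod *
        of_real (c \<mu> * real (card (e_good (sorted_list_of_multiset \<mu>))))"
      using psum_coeff_e[of \<mu>] by simp
  qed
  finally show ?thesis by (simp flip: sum_distrib_left)
qed

lemma finite_e_good: "finite (e_good ls)"
  using finite_e_choices by (simp add: e_good_def)

text \<open>The set of all variables contains every block, so \<open>e_N\<close> contributes
  whatever the block sizes are.\<close>

lemma card_e_good_whole: "0 < card (e_good [N])"
proof -
  have "{..<N} \<inter> block b = block b" for b using block_subset by blast
  then have "[{..<N}] \<in> e_good [N]" by (simp add: e_good_def e_choices_def card_block)
  then show ?thesis using finite_e_good by (auto simp: card_gt_0_iff)
qed

text \<open>A nonempty intersection with the only block must be all of it. Hence, among the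
  \<open>e_\<mu>\<close> of degree \<open>N\<close>, only \<open>e_N\<close> contributes at
  \<open>p_N\<close>.\<close>

lemma e_good_single_block:
  assumes k: "k = 1" and Ss: "Ss \<in> e_good ls"
  shows "\<exists>l\<in>set ls. N \<le> l"
proof -
  note L0 = single_block[OF k]
  have "0 < L 0" using L_pos k by simp
  moreover have "(\<Sum>j<length ls. card (Ss ! j \<inter> block 0)) = L 0"
    using Ss unfolding e_good_def using k by simp
  ultimately have "(\<Sum>j<length ls. card (Ss ! j \<inter> block 0)) \<noteq> 0" by linarith
  then obtain j where j: "j < length ls" "card (Ss ! j \<inter> block 0) \<noteq> 0"
    by (elim sum.not_neutral_contains_not_neutral) simp
  moreover have "card (Ss ! j \<inter> block 0) = 0 \<or> card (Ss ! j \<inter> block 0) = L 0"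
    using Ss j(1) unfolding e_good_def using k by simp
  ultimately have "card (Ss ! j \<inter> block 0) = N" using L0 by simp
  moreover have "Ss ! j \<subseteq> {..<N}" "card (Ss ! j) = ls ! j"
    using Ss j by (auto simp: e_good_def e_choices_def)
  ultimately have "N \<le> ls ! j"
    using card_mono[of "Ss ! j" "Ss ! j \<inter> block 0"] finite_subset[of "Ss ! j" "{..<N}"] by simp
  then show ?thesis using j by auto
qed

end

text \<open>Wolfgang's necessary condition for e-positivity, for trees. The same expansion is tested
  at \<open>p_\<mu>\<close> and at \<open>p_n\<close>.\<close>

lemma e_positive_tree_connected_partition:
  assumes V: "leaf_built E V" and sym: "\<And>u v. E u v \<Longrightarrow> E v u" and irr: "\<And>v. \<not> E v v"
    and pos: "e_positive V E" and \<mu>: "int_partition (card V) \<mu>"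
  shows "\<exists>P. connected_partition V E P \<and> partition_type P = \<mu>"
proof (rule ccontr)
  assume missing: "\<not> ?thesis"
  define n where "n = card V"
  have fin: "finite V" using V by (rule leaf_built_finite)
  have "V \<noteq> {}" using V by (cases rule: leaf_built.cases) auto
  then have n: "0 < n" using fin by (simp add: n_def card_gt_0_iff)
  let ?P = "{\<mu>. int_partition n \<mu>}"
  obtain c where c: "\<And>\<mu>. 0 \<le> c \<mu>"
    "\<And>\<alpha>. real (chrom_coeff V E n \<alpha>) = (\<Sum>\<mu>\<in>?P. c \<mu> * real (e_coeff n \<mu> \<alpha>))"
    using pos unfolding e_positive_def Let_def n_def by blast
  have whole: "{#n#} \<in> ?P" using n by (simp add: int_partition_def)
  define ls where "ls = sorted_list_of_multiset \<mu>"
  have ls: "mset ls = \<mu>" by (simp add: ls_def)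
  have "sum_mset \<mu> = sum_list ls" using sum_mset_sum_list[of ls] ls by simp
  then have "(\<Sum>b<length ls. ls ! b) = sum_mset \<mu>" by (simp add: sum_list_sum_nth atLeast0LessThan)
  then have sum_ls: "(\<Sum>b<length ls. ls ! b) = n" using \<mu> by (simp add: int_partition_def n_def)
  have type: "image_mset ((!) ls) (mset_set {..<length ls}) = \<mu>"
    by (metis atLeast0LessThan ls map_nth mset_map mset_upt)
  have "0 < ls ! b" if "b < length ls" for b
    using \<mu> nth_mem[OF that] unfolding int_partition_def ls[symmetric] by simp
  then obtain blk r z \<omega> where "root_blocks n (length ls) ((!) ls) blk r z \<omega>"
    using ex_root_blocks[of "length ls" "(!) ls"] sum_ls by auto
  then interpret R: root_blocks n "length ls" "(!) ls" blk r z \<omega> .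
  have "R.psum_coeff (chrom_coeff V E n) = 0"
  proof (rule R.psum_coeff_chrom_eq_0[OF fin _ sym])
    show "\<nexists>P. connected_partition V E P \<and>
        partition_type P = image_mset ((!) ls) (mset_set {..<length ls})"
      using missing unfolding type .
  qed (simp_all add: n_def)
  then have "(\<Sum>\<mu>\<in>?P. c \<mu> * real (card (R.e_good (sorted_list_of_multiset \<mu>)))) = 0"
    using R.psum_coeff_e_expansion[OF c(2)] R.root_prod_nonzero
    by (simp del: of_real_sum of_real_mult)
  \<comment> \<open>A vanishing sum of nonnegative terms has only zero terms. The count for
    \<open>{#n#}\<close> is positive, which forces its coefficient to be 0.\<close>
  then have "c {#n#} * real (card (R.e_good (sorted_list_of_multiset {#n#}))) = 0"
    using whole c(1) finite_int_partitions by (subst (asm) sum_nonneg_eq_0_iff) auto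
  then have cn: "c {#n#} = 0" using R.card_e_good_whole by simp
  \<comment> \<open>One block of size \<open>n\<close> tests \<open>p_n\<close>. Only
    \<open>{#n#}\<close> could contribute there, so the expansion yields 0, contrary to the tree
    computation.\<close>
  obtain blk' r' z' \<omega>' where "root_blocks n 1 (\<lambda>_. n) blk' r' z' \<omega>'"
    using ex_root_blocks[of 1 "\<lambda>_. n"] n by auto
  then interpret Q: root_blocks n 1 "\<lambda>_. n" blk' r' z' \<omega>' .
  have "c \<nu> * real (card (Q.e_good (sorted_list_of_multiset \<nu>))) = 0" if \<nu>: "int_partition n \<nu>" for \<nu>
  proof (cases "\<nu> = {#n#}")
    case False
    have "l < n" if "l \<in># \<nu>" for l
    proof -
      have "l \<le> n" using \<nu> that by (auto simp: int_partition_def dest!: multi_member_split)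
      moreover have "l \<noteq> n" using int_partition_containing_all[OF \<nu>] that False by blast
      ultimately show ?thesis by simp
    qed
    then have "Q.e_good (sorted_list_of_multiset \<nu>) = {}"
      using Q.e_good_single_block[OF refl] by (fastforce simp: not_le[symmetric])
    then show ?thesis by simp
  qed (simp add: cn)
  then have "(\<Sum>\<nu>\<in>?P. c \<nu> * real (card (Q.e_good (sorted_list_of_multiset \<nu>)))) = 0"
    by (intro sum.neutral) blast
  then have "Q.psum_coeff (chrom_coeff V E n) = 0"
    by (simp only: Q.psum_coeff_e_expansion[OF c(2)] of_real_0 mult_zero_right)
  then show False using Q.psum_coeff_chrom_tree[OF V _ refl sym irr] by (simp add: n_def)
qed

section \<open>Spiders as trees\<close>

lemma spider_E_sym: "spider_E lam u v \<Longrightarrow> spider_E lam v u"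
  unfolding spider_E_def Let_def by blast

lemma spider_E_irrefl: "\<not> spider_E lam v v"
  by (cases v) (simp add: spider_E_def)

text \<open>A vertex at maximal distance from the centre is a leaf.\<close>
lemma leaf_built_subspider:
  assumes "finite D" "(0,0) \<in> D" "D \<subseteq> spider_V lam"
    and closed: "\<And>i j. (i, Suc j) \<in> D \<Longrightarrow> (if j = 0 then (0,0) else (i, j)) \<in> D"
  shows "leaf_built (spider_E lam) D"
  using assms
proof (induction "card D" arbitrary: D rule: less_induct)
  case less
  show ?case
  proof (cases "D = {(0,0)}")
    case True
    then show ?thesis by (simp add: leaf_built.single)
  next
    case False
    let ?D = "D - {(0,0)}"
    have "?D \<noteq> {}" "finite ?D" using less.prems(1,2) False by auto
    then obtain v where v: "v \<in> ?D" "snd v = Max (snd ` ?D)"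
      using Max_in[of "snd ` ?D"] by fastforce
    have v_max: "snd w \<le> snd v" if "w \<in> ?D" for w
      unfolding v(2) using that \<open>finite ?D\<close> by (intro Max_ge) auto
    obtain i j where vij: "v = (i, Suc j)" "1 \<le> i"
      using v(1) less.prems(3) by (cases v; cases "snd v") (auto simp: spider_V_def)
    let ?u = "if j = 0 then (0,0) else (i, j)"
    let ?A = "D - {v}"
    have max: "b \<le> Suc j" if "(a, b) \<in> D" for a b
      using v_max[of "(a, b)"] that vij by (cases "(a, b) = (0, 0)") auto
    have A: "leaf_built (spider_E lam) ?A"
    proof (rule less.hyps)
      show "card ?A < card D" using less.prems(1) v(1) by (intro psubset_card_mono) auto
      fix a b assume ab: "(a, Suc b) \<in> ?A"
      \<comment> \<open>Hence the inward neighbour \<open>(a, b)\<close> is not the removed vertex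
        \<open>v\<close>, whose second coordinate is \<open>Suc j\<close>, and \<open>?A\<close>
        stays closed.\<close>
      then have "b \<le> j" using max by fastforce
      then show "(if b = 0 then (0,0) else (a, b)) \<in> ?A"
        using less.prems(4)[of a b] ab vij by (auto split: if_splits)
    qed (use less.prems(1-3) vij in auto)
    have uA: "?u \<in> ?A" using less.prems(4)[of i j] v(1) vij by auto
    have nbr: "spider_E lam v w \<longleftrightarrow> w = ?u" if w: "w \<in> ?A" for w
    proof -
      obtain a b where ab: "w = (a, b)" by (cases w)
      have "v \<in> spider_V lam" "w \<in> spider_V lam" using v(1) w less.prems(3) by auto
      then have "spider_E lam v w \<longleftrightarrow>
          (a = 0 \<and> b = 0 \<and> j = 0) \<or> (a = i \<and> b = j) \<or> (a = i \<and> b = Suc (Suc j))"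
        using ab vij by (auto simp: spider_E_def)
      moreover have "b \<noteq> Suc (Suc j)" using max[of a b] w ab by auto
      moreover have "\<not> (a = i \<and> b = 0)"
        using \<open>w \<in> spider_V lam\<close> ab vij(2) by (auto simp: spider_V_def)
      ultimately show ?thesis using ab by auto
    qed
    have "leaf_built (spider_E lam) (insert v ?A)"
      by (rule leaf_built.attach[OF A _ uA nbr]) auto
    then show ?thesis using v(1) by (simp add: insert_absorb)
  qed
qed

lemma leaf_built_spider: "leaf_built (spider_E lam) (spider_V lam)"
  by (rule leaf_built_subspider[OF finite_spider_V]) (auto simp: spider_V_def)

theorem theorem3p10:
  fixes lam :: "nat list"
  assumes "length lam \<ge> 6"
    and "\<forall>k\<in>set lam. 0 < k"
    and "sorted (rev lam)"
  shows "(\<exists>\<mu>. int_partition (card (spider_V lam)) \<mu> \<and>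
            \<not> (\<exists>P. connected_partition (spider_V lam) (spider_E lam) P \<and> partition_type P = \<mu>))
         \<and> \<not> e_positive (spider_V lam) (spider_E lam)"
proof -
  obtain \<mu> where \<mu>: "int_partition (card (spider_V lam)) \<mu>"
    "\<not> (\<exists>P. connected_partition (spider_V lam) (spider_E lam) P \<and> partition_type P = \<mu>)"
    using six_legs_missing_type[OF assms] by blast
  have "\<not> e_positive (spider_V lam) (spider_E lam)"
  proof
    assume pos: "e_positive (spider_V lam) (spider_E lam)"
    have "\<exists>P. connected_partition (spider_V lam) (spider_E lam) P \<and> partition_type P = \<mu>"
      by (rule e_positive_tree_connected_partition[OF leaf_built_spider spider_E_sym spider_E_irrefl pos \<mu>(1)])
    then show False using \<mu>(2) by contradiction
  qed
  with \<mu> show ?thesis by blast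
qed

end
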